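(* Let $V\in C^\infty(\mathbb T^2;\mathbb R^2)$ be divergence free with mean zero and let $p\in\mathbb R^2$. Let $c_p=\inf_{\phi\in C^1(\mathbb T^2)}\max_{\mathbb T^2}\{V(x)\cdot(p+D\phi)\}$. Then $c_p>0$ if and only if there exists a periodic orbit $\xi$ with period $T$ such that $$p\cdot(\xi(T)-\xi(0))>0.$$
   Context: $\mathbb T^2=\mathbb R^2/\mathbb Z^2$; functions on it are $\mathbb Z^2$-periodic functions on $\mathbb R^2$. A smooth curve $\xi:\mathbb R\to\mathbb R^2$ is an orbit if $\dot\xi(t)=V(\xi(t))$ for all $t$. It is a periodic orbit with period $T>0$ if it is an orbit and $\xi(T)-\xi(0)\in\mathbb Z^2$. *)

theory Defs
  imports "HOL-Analysis.Analysis"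
begin

fun C_diff :: "nat \<Rightarrow> ('a::euclidean_space \<Rightarrow> 'b::real_normed_vector) \<Rightarrow> bool" where
  "C_diff 0 f \<longleftrightarrow> continuous_on UNIV f"
| "C_diff (Suc k) f \<longleftrightarrow> f differentiable_on UNIV \<and>
     (\<forall>v. C_diff k (\<lambda>x. frechet_derivative f (at x) v))"
  \<comment> \<open>On a finite-dimensional domain, continuity of all directional derivatives is
      continuity of the derivative, so this is the usual class of \<open>k\<close> times continuously
      differentiable functions on the whole space.\<close>

definition C_infty :: "('a::euclidean_space \<Rightarrow> 'b::real_normed_vector) \<Rightarrow> bool" where
  "C_infty f \<longleftrightarrow> (\<forall>k. C_diff k f)"

definition Z2 :: "(real^2) set" where
  "Z2 = {v. \<forall>i. v $ i \<in> \<int>}"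

definition Z2_periodic :: "(real^2 \<Rightarrow> 'b) \<Rightarrow> bool" where
  "Z2_periodic f \<longleftrightarrow> (\<forall>x. \<forall>k\<in>Z2. f (x + k) = f x)"

definition gradient :: "(real^2 \<Rightarrow> real) \<Rightarrow> real^2 \<Rightarrow> real^2" where
  "gradient \<phi> x = (\<chi> i. frechet_derivative \<phi> (at x) (axis i 1))"

definition divergence :: "(real^2 \<Rightarrow> real^2) \<Rightarrow> real^2 \<Rightarrow> real" where
  "divergence V x = (\<Sum>i\<in>UNIV. frechet_derivative V (at x) (axis i 1) $ i)"

definition mean_torus :: "(real^2 \<Rightarrow> real^2) \<Rightarrow> real^2" where
  "mean_torus V = integral (cbox 0 1) V"
  \<comment> \<open>Here \<open>1\<close> is the vector with both components one: \<open>cbox 0 1\<close> is the unit square,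
      a fundamental domain of area one.\<close>

definition effective_c :: "(real^2 \<Rightarrow> real^2) \<Rightarrow> real^2 \<Rightarrow> real" where
  "effective_c V p =
     (INF \<phi>\<in>{\<phi> :: real^2 \<Rightarrow> real. C_diff 1 \<phi> \<and> Z2_periodic \<phi>}.
        SUP x. V x \<bullet> (p + gradient \<phi> x))"
  \<comment> \<open>For continuous periodic \<open>V\<close> each supremum is a maximum, by compactness of the torus.
      For divergence-free, mean-zero \<open>V\<close> each such maximum is at least the mean of
      \<open>V \<bullet> (p + D\<phi>)\<close>, which is zero, so the infimum is over a nonempty set of reals bounded below.\<close>

definition orbit :: "(real^2 \<Rightarrow> real^2) \<Rightarrow> (real \<Rightarrow> real^2) \<Rightarrow> bool" where
  "orbit V \<xi> \<longleftrightarrow> C_infty \<xi> \<and> (\<forall>t. (\<xi> has_vector_derivative V (\<xi> t)) (at t))"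

definition periodic_orbit :: "(real^2 \<Rightarrow> real^2) \<Rightarrow> (real \<Rightarrow> real^2) \<Rightarrow> real \<Rightarrow> bool" where
  "periodic_orbit V \<xi> T \<longleftrightarrow> T > 0 \<and> orbit V \<xi> \<and> \<xi> T - \<xi> 0 \<in> Z2"

end

(* A positive drift along a periodic orbit bounds every maximum of V . (p + D phi) below, by
   integration along the orbit. Conversely, V is, up to a rotation by a right angle, the gradient of
   a stream function H, which descends to the torus because V has mean zero. Near a point where V is
   not small a level set of H is a single orbit arc, so an orbit that returns to the same small cell
   of the torus closes up. If no periodic orbit drifts in direction p, every return is harmless, and
   since there are finitely many cells the drift p . (xi T - xi 0) is at most eps T + C for all
   orbits. Averaging p . (F^n x - x) over the iterates of the Euler map F of V gives a C^1 function
   phi with V . (p + D phi) close to p . (F^N x - x) / T, hence at most of order eps. Working with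
   Euler iterates avoids differentiability of the flow in its initial point. *)

theory Submission
  imports Defs
begin

subsection \<open>Smooth functions and orbits\<close>

text \<open>Mean zero is essential: for constant \<open>V\<close> of irrational slope and
  \<open>p = V\<close>, averaging over the torus gives c_p \<ge> |V|^2 > 0, yet no orbit closes. It
  enters through the periodicity of H: a point that returns modulo the lattice, once shifted back,
  lies on the level set of the orbit itself. The term eps T pays for the region where V is small:
  there no flow box is available, but the orbit is slow.

  The average works because it telescopes. For an exact flow, D(F^n)(x) V(x) = V(F^n x), so
  differentiating p . (F^n x - x) along V gives p . V(F^n x) - p . V(x). The second term cancels p .
  V(x), and the mean of the first is displacement over time. T must be large to absorb C; only
  afterwards can the step T / N be made small enough to beat an Euler error that grows like exp (T
  L).\<close>

lemma C_diff_add: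
  assumes "C_diff k f" "C_diff k g"
  shows "C_diff k (\<lambda>x. f x + g x)"
  using assms
proof (induction k arbitrary: f g)
  case 0
  then show ?case by (auto intro: continuous_intros)
next
  case (Suc k)
  have f: "f differentiable at x" and g: "g differentiable at x" for x
    using Suc.prems by (auto simp: differentiable_on_def)
  have "frechet_derivative (\<lambda>x. f x + g x) (at x) v =
      frechet_derivative f (at x) v + frechet_derivative g (at x) v" for x v
    by (subst frechet_derivative_at[symmetric, OF has_derivative_add])
       (use f g in \<open>auto simp: frechet_derivative_works\<close>)
  then show ?case
    using Suc by (auto simp: differentiable_on_def intro!: differentiable_add)
qed

lemma C_diff_sum:
  fixes f :: "'i \<Rightarrow> 'a::euclidean_space \<Rightarrow> 'b::real_normed_vector"
  assumes "\<And>i. i \<in> I \<Longrightarrow> C_diff k (f i)"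
  shows "C_diff k (\<lambda>x. \<Sum>i\<in>I. f i x)"
proof -
  have "frechet_derivative (\<lambda>x. 0) (at x) = (\<lambda>v. 0 :: 'b)" for x :: 'a
    by (metis frechet_derivative_at has_derivative_const)
  then have zero: "C_diff k (\<lambda>x::'a. 0 :: 'b)"
    by (induction k) auto
  show ?thesis
    using assms by (induction I rule: infinite_finite_induct) (auto simp: zero intro: C_diff_add)
qed

lemma C_infty_imp_differentiable: "C_infty f \<Longrightarrow> f differentiable (at x)"
  unfolding C_infty_def using C_diff.simps(2)[of 0 f] by (auto simp: differentiable_on_def)

lemma C_infty_imp_has_derivative:
  "C_infty f \<Longrightarrow> (f has_derivative frechet_derivative f (at x)) (at x)"
  by (simp add: C_infty_imp_differentiable flip: frechet_derivative_works)

lemma C_infty_imp_continuous_on: "C_infty f \<Longrightarrow> continuous_on S f"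
  unfolding C_infty_def by (metis C_diff.simps(1) continuous_on_subset subset_UNIV)

lemma C_infty_frechet_derivative:
  "C_infty f \<Longrightarrow> C_infty (\<lambda>x. frechet_derivative f (at x) v)"
  unfolding C_infty_def using C_diff.simps(2)[of _ f] by blast

lemma C_infty_bounded_linear:
  assumes "bounded_linear h" "C_infty f"
  shows "C_infty (\<lambda>x. h (f x))"
proof -
  have "C_diff k (\<lambda>x. h (f x))" for k
    using assms(2)
  proof (induction k arbitrary: f)
    case 0
    then show ?case
      by (simp add: bounded_linear.continuous_on[OF assms(1)] C_infty_imp_continuous_on)
  next
    case (Suc k)
    have D: "((\<lambda>x. h (f x)) has_derivative (\<lambda>v. h (frechet_derivative f (at x) v))) (at x)" for x
      by (intro bounded_linear.has_derivative[OF assms(1)] C_infty_imp_has_derivative Suc.prems)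
    show ?case
      using Suc.IH[OF C_infty_frechet_derivative[OF Suc.prems]]
      by (auto simp: frechet_derivative_at[OF D, symmetric] differentiable_on_def
          intro: differentiableI[OF D])
  qed
  then show ?thesis by (simp add: C_infty_def)
qed

lemma C_infty_scaleR:
  assumes "C_infty g" "C_infty f"
  shows "C_infty (\<lambda>x. g x *\<^sub>R f x)"
proof -
  have "C_diff k (\<lambda>x. g x *\<^sub>R f x)" for k
    using assms
  proof (induction k arbitrary: f g)
    case 0
    then show ?case
      by (simp add: continuous_on_scaleR C_infty_imp_continuous_on)
  next
    case (Suc k)
    have D: "((\<lambda>x. g x *\<^sub>R f x) has_derivative (\<lambda>v. g x *\<^sub>R frechet_derivative f (at x) v +
        frechet_derivative g (at x) v *\<^sub>R f x)) (at x)" for x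
      by (intro has_derivative_scaleR C_infty_imp_has_derivative Suc.prems)
    show ?case
      using C_diff_add[OF Suc.IH[OF Suc.prems(1) C_infty_frechet_derivative[OF Suc.prems(2)]]
          Suc.IH[OF C_infty_frechet_derivative[OF Suc.prems(1)] Suc.prems(2)]]
      by (auto simp: frechet_derivative_at[OF D, symmetric] differentiable_on_def
          intro: differentiableI[OF D])
  qed
  then show ?thesis by (simp add: C_infty_def)
qed

lemma linear_eq_sum_Basis:
  assumes "bounded_linear f"
  shows "f v = (\<Sum>b\<in>Basis. (v \<bullet> b) *\<^sub>R f b)"
proof -
  have "f v = f (\<Sum>b\<in>Basis. (v \<bullet> b) *\<^sub>R b)" by (simp add: euclidean_representation)
  also have "\<dots> = (\<Sum>b\<in>Basis. (v \<bullet> b) *\<^sub>R f b)"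
    using assms by (simp add: linear_sum linear_scale bounded_linear.linear)
  finally show ?thesis .
qed

text \<open>\<open>C_diff\<close> speaks only of derivatives in a fixed direction; expanding
  \<open>V x\<close> in the basis reduces the moving direction to those.\<close>

lemma C_infty_directional:
  fixes W :: "'a::euclidean_space \<Rightarrow> 'b::real_normed_vector"
  assumes "C_infty W" "C_infty V"
  shows "C_infty (\<lambda>x. frechet_derivative W (at x) (V x))"
proof -
  have "frechet_derivative W (at x) (V x) =
      (\<Sum>b\<in>Basis. (V x \<bullet> b) *\<^sub>R frechet_derivative W (at x) b)" for x
    by (intro linear_eq_sum_Basis has_derivative_bounded_linear[OF C_infty_imp_has_derivative] assms)
  moreover have "C_infty (\<lambda>x. (V x \<bullet> b) *\<^sub>R frechet_derivative W (at x) b)" for b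
    by (rule C_infty_scaleR[OF C_infty_bounded_linear[OF bounded_linear_inner_left assms(2)]
          C_infty_frechet_derivative[OF assms(1)]])
  ultimately show ?thesis
    unfolding C_infty_def by (simp add: C_diff_sum)
qed

text \<open>Bootstrapping: the derivative of \<open>W (\<xi> t)\<close> is the derivative of
  \<open>W\<close> along \<open>V\<close>, again a smooth field evaluated on \<open>\<xi>\<close>.
  Induction over all smooth \<open>W\<close> at once avoids a higher-order chain rule.\<close>

lemma C_infty_solution:
  fixes V :: "'a::euclidean_space \<Rightarrow> 'a"
  assumes "C_infty V" and sol: "\<And>t. (\<xi> has_vector_derivative V (\<xi> t)) (at t)"
  shows "C_infty \<xi>"
proof -
  have comp: "C_diff k (\<lambda>t. W (\<xi> t))" if "C_infty W" for k and W :: "'a \<Rightarrow> 'a"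
    using that
  proof (induction k arbitrary: W)
    case 0
    have "continuous_on UNIV \<xi>"
      using sol by (meson continuous_at_imp_continuous_on has_vector_derivative_continuous)
    then show ?case
      using continuous_on_compose2[OF C_infty_imp_continuous_on[OF 0, of UNIV]] by auto
  next
    case (Suc k)
    have D: "((\<lambda>t. W (\<xi> t)) has_derivative
        (\<lambda>v. v *\<^sub>R frechet_derivative W (at (\<xi> t)) (V (\<xi> t)))) (at t)" for t
    proof -
      have "((\<lambda>t. W (\<xi> t)) has_derivative
          (\<lambda>v. frechet_derivative W (at (\<xi> t)) (v *\<^sub>R V (\<xi> t)))) (at t)"
        using has_derivative_compose[OF sol[unfolded has_vector_derivative_def]
            C_infty_imp_has_derivative[OF Suc.prems]] .
      then show ?thesis
        using linear_scale[OF has_derivative_linear[OF C_infty_imp_has_derivative[OF Suc.prems]]]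
        by simp
    qed
    have "C_infty (\<lambda>x. v *\<^sub>R frechet_derivative W (at x) (V x))" for v
      by (rule C_infty_bounded_linear[OF bounded_linear_scaleR_right
            C_infty_directional[OF Suc.prems assms(1)]])
    from Suc.IH[OF this] show ?case
      by (auto simp: frechet_derivative_at[OF D, symmetric] differentiable_on_def
          intro: differentiableI[OF D])
  qed
  have "C_diff k \<xi>" for k
  proof (cases k)
    case 0
    then show ?thesis
      using sol by (auto intro!: continuous_at_imp_continuous_on has_vector_derivative_continuous)
  next
    case (Suc n)
    have D: "(\<xi> has_derivative (\<lambda>v. v *\<^sub>R V (\<xi> t))) (at t)" for t
      using sol by (simp add: has_vector_derivative_def)
    show ?thesis
      unfolding Suc
      using comp[OF C_infty_bounded_linear[OF bounded_linear_scaleR_right assms(1)]]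
      by (auto simp: frechet_derivative_at[OF D, symmetric] differentiable_on_def
          intro: differentiableI[OF D])
  qed
  then show ?thesis by (simp add: C_infty_def)
qed

lemma orbitI:
  assumes "C_infty V" "\<And>t. (\<xi> has_vector_derivative V (\<xi> t)) (at t)"
  shows "orbit V \<xi>"
  using assms C_infty_solution by (auto simp: orbit_def)

subsection \<open>Periodic functions, and two discrete estimates\<close>

lemma Z2_reduce: "\<exists>k\<in>Z2. x - k \<in> cbox 0 1"
proof
  show "(\<chi> i. of_int \<lfloor>x $ i\<rfloor>) \<in> Z2" by (simp add: Z2_def)
  show "x - (\<chi> i. of_int \<lfloor>x $ i\<rfloor>) \<in> cbox 0 1"
    by (simp add: mem_box_cart) (metis add.commute diff_le_eq le_less real_of_int_floor_add_one_gt)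
qed

lemma Z2_periodicD: "Z2_periodic f \<Longrightarrow> k \<in> Z2 \<Longrightarrow> f (x + k) = f x"
  by (simp add: Z2_periodic_def)

lemma Z2_periodic_image: "Z2_periodic f \<Longrightarrow> range f = f ` cbox 0 1"
proof (intro equalityI subsetI)
  fix y assume per: "Z2_periodic f" and "y \<in> range f"
  then obtain x where "y = f x" by blast
  moreover obtain k where "k \<in> Z2" "x - k \<in> cbox 0 1" using Z2_reduce by blast
  ultimately show "y \<in> f ` cbox 0 1"
    using Z2_periodicD[OF per, of k "x - k"] by auto
qed auto

lemma Z2_periodic_compact_range:
  fixes f :: "real^2 \<Rightarrow> 'b::topological_space"
  assumes "Z2_periodic f" "continuous_on UNIV f"
  shows "compact (range f)"
  unfolding Z2_periodic_image[OF assms(1)]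
  by (intro compact_continuous_image continuous_on_subset[OF assms(2)]) auto

lemma Z2_periodic_bounded:
  fixes f :: "real^2 \<Rightarrow> 'b::real_normed_vector"
  assumes "Z2_periodic f" "continuous_on UNIV f"
  obtains B where "B > 0" "\<And>x. norm (f x) \<le> B"
  using compact_imp_bounded[OF Z2_periodic_compact_range[OF assms]]
  unfolding bounded_pos by auto

lemma frechet_derivative_periodic:
  assumes "Z2_periodic f" "\<And>x. f differentiable (at x)"
  shows "Z2_periodic (\<lambda>x. frechet_derivative f (at x))"
  unfolding Z2_periodic_def
proof (intro allI ballI)
  fix x k :: "real^2" assume k: "k \<in> Z2"
  have "((\<lambda>x. f (x + k)) has_derivative (\<lambda>v. frechet_derivative f (at (x + k)) v)) (at x)"
    by (rule has_derivative_compose[where g = f and f = "\<lambda>x. x + k" and f' = "\<lambda>v. v"])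
       (auto intro!: derivative_eq_intros simp: assms(2) frechet_derivative_works[symmetric])
  then show "frechet_derivative f (at (x + k)) = frechet_derivative f (at x)"
    by (simp add: Z2_periodicD[OF assms(1) k] frechet_derivative_at)
qed

lemma C1_periodic_lipschitz:
  fixes f :: "real^2 \<Rightarrow> 'b::real_normed_vector"
  assumes per: "Z2_periodic f" and C1: "C_diff 1 f"
  obtains L where "L > 0" "\<And>x y. norm (f x - f y) \<le> L * norm (x - y)"
    "\<And>x v. norm (frechet_derivative f (at x) v) \<le> L * norm v"
proof -
  have diff: "f differentiable (at x)" for x
    using C1 by (auto simp: differentiable_on_def)
  have D: "(f has_derivative frechet_derivative f (at x)) (at x)" for x
    using diff frechet_derivative_works by blast
  have "\<exists>B>0. \<forall>x. norm (frechet_derivative f (at x) b) \<le> B" for b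
  proof -
    have "Z2_periodic (\<lambda>x. frechet_derivative f (at x) b)"
      using frechet_derivative_periodic[OF per diff] by (simp add: Z2_periodic_def)
    moreover have "continuous_on UNIV (\<lambda>x. frechet_derivative f (at x) b)"
      using C1 by simp
    ultimately show ?thesis using Z2_periodic_bounded by metis
  qed
  then obtain B where B: "\<And>b. B b > 0" "\<And>b x. norm (frechet_derivative f (at x) b) \<le> B b"
    by metis
  define L where "L = (\<Sum>b\<in>Basis. B b)"
  have le: "norm (frechet_derivative f (at x) v) \<le> L * norm v" for x v
  proof -
    have "norm (frechet_derivative f (at x) v) =
        norm (\<Sum>b\<in>Basis. (v \<bullet> b) *\<^sub>R frechet_derivative f (at x) b)"
      using linear_eq_sum_Basis[OF has_derivative_bounded_linear[OF D]] by metis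
    also have "\<dots> \<le> (\<Sum>b\<in>Basis. norm v * B b)"
      by (rule sum_norm_le) (auto intro!: mult_mono B Basis_le_norm)
    finally show ?thesis by (simp add: L_def sum_distrib_left mult.commute)
  qed
  have "norm (f x - f y) \<le> L * norm (x - y)" for x y
    by (rule differentiable_bound[where S = UNIV])
       (auto intro!: onorm_le le has_derivative_at_withinI[OF D])
  moreover have "L > 0"
    unfolding L_def by (intro sum_pos) (auto simp: B)
  ultimately show ?thesis using le that by blast
qed

lemma inner_gradient:
  assumes "\<phi> differentiable (at x)"
  shows "v \<bullet> gradient \<phi> x = frechet_derivative \<phi> (at x) v"
proof -
  have "frechet_derivative \<phi> (at x) v = (\<Sum>b\<in>Basis. (v \<bullet> b) *\<^sub>R frechet_derivative \<phi> (at x) b)"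
    using assms by (intro linear_eq_sum_Basis)
      (metis frechet_derivative_works has_derivative_bounded_linear)
  also have "\<dots> = (\<Sum>i\<in>UNIV. v $ i * frechet_derivative \<phi> (at x) (axis i 1))"
    by (simp add: Basis_vec_def UNION_singleton_eq_range sum.reindex axis_eq_axis inj_on_def
        inner_axis)
  finally show ?thesis by (simp add: gradient_def inner_vec_def)
qed

text \<open>Here \<open>a n\<close> stands for the drift of an orbit at the n-th sample time and
  \<open>G\<close> for the fast times. Induction on the number of cells: skip from the first fast
  time to the last visit to its cell at cost \<open>K\<close>, pay \<open>B\<close> for one further
  step, and that cell never occurs again. However long the run, only \<open>card S\<close> such
  jumps are paid for.\<close>

lemma jump_bound:
  fixes a :: "nat \<Rightarrow> real"
  assumes "finite S"
    and slow: "\<And>n. n \<notin> G \<Longrightarrow> a (Suc n) - a n \<le> \<alpha>"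
    and step: "\<And>n. a (Suc n) - a n \<le> B"
    and jump: "\<And>m n. m < n \<Longrightarrow> m \<in> G \<Longrightarrow> n \<in> G \<Longrightarrow> cell m = cell n \<Longrightarrow> a n - a m \<le> K"
    and nonneg: "\<alpha> \<ge> 0" "B \<ge> 0" "K \<ge> 0"
    and "\<And>n. i \<le> n \<Longrightarrow> n < j \<Longrightarrow> n \<in> G \<Longrightarrow> cell n \<in> S" "i \<le> j"
  shows "a j - a i \<le> real (j - i) * \<alpha> + real (card S) * (K + B)"
  using assms(1,8,9)
proof (induction "card S" arbitrary: S i)
  have slow_run: "a n - a m \<le> real (n - m) * \<alpha>" if "m \<le> n" "\<And>l. m \<le> l \<Longrightarrow> l < n \<Longrightarrow> l \<notin> G" for m n
    using that
  proof (induction n rule: dec_induct)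
    case (step n)
    have "a (Suc n) - a n \<le> \<alpha>" using step.prems[of n] step.hyps by (intro slow) auto
    moreover have "a n - a m \<le> real (n - m) * \<alpha>"
      by (rule step.IH, rule step.prems) auto
    moreover have "real (Suc n - m) = real (n - m) + 1" using step.hyps by auto
    ultimately show ?case by (simp add: distrib_right)
  qed simp
  {
    case 0
    then show ?case using slow_run[of i j] by auto
  next
    case (Suc c)
    let ?P = "\<lambda>n. i \<le> n \<and> n < j \<and> n \<in> G"
    show ?case
    proof (cases "\<exists>n. ?P n")
      case False
      then have "a j - a i \<le> real (j - i) * \<alpha>" using slow_run[of i j] Suc.prems by auto
      also have "\<dots> \<le> real (j - i) * \<alpha> + real (card S) * (K + B)" using nonneg by simp
      finally show ?thesis .
    next
      case True
      obtain n0 where n0: "?P n0" and n0_min: "\<And>l. ?P l \<Longrightarrow> n0 \<le> l"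
        using LeastI_ex[of ?P, OF True] Least_le[of ?P] by (rule that)
      have n0_least: "l \<notin> G" if "i \<le> l" "l < n0" for l
        using that n0_min[of l] n0 by auto
      \<comment> \<open>The last visit, not the next one: after it the cell can be removed from
        \<open>S\<close>.\<close>
      let ?Q = "\<lambda>n. ?P n \<and> cell n = cell n0"
      have Qb: "\<forall>n. ?Q n \<longrightarrow> n \<le> j" by auto
      obtain n1 where n1: "?Q n1" and n1_max: "\<And>l. ?Q l \<Longrightarrow> l \<le> n1"
      proof (rule that)
        show "?Q (GREATEST n. ?Q n)" by (rule GreatestI_nat[of ?Q n0 j]) (use n0 Qb in auto)
        show "l \<le> (GREATEST n. ?Q n)" if "?Q l" for l
          by (rule Greatest_le_nat[of ?Q l j]) (use that Qb in auto)
      qed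
      have "n0 \<le> n1" using n1_max n0 by auto
      have "a n0 - a i \<le> real (n0 - i) * \<alpha>" using slow_run[of i n0] n0 n0_least by auto
      moreover have "a n1 - a n0 \<le> K"
      proof (cases "n0 = n1")
        case False
        show ?thesis by (rule jump) (use False n0 n1 \<open>n0 \<le> n1\<close> in simp_all)
      qed (use nonneg in simp)
      moreover have "a (Suc n1) - a n1 \<le> B" by (rule step)
      moreover have "a j - a (Suc n1) \<le> real (j - Suc n1) * \<alpha> + real (card (S - {cell n0})) * (K + B)"
      proof (rule Suc.hyps(1))
        show "c = card (S - {cell n0})" using Suc.hyps(2) Suc.prems n0 by auto
        show "cell n \<in> S - {cell n0}" if "Suc n1 \<le> n" "n < j" "n \<in> G" for n
          using that Suc.prems(2)[of n] n1 n1_max[of n] by auto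
      qed (use n1 Suc.prems in auto)
      moreover have "card S = Suc (card (S - {cell n0}))"
        using Suc.prems n0 by (metis card_Suc_Diff1)
      ultimately have "a j - a i \<le> (real (n0 - i) + real (j - Suc n1)) * \<alpha> + real (card S) * (K + B)"
        by (simp add: algebra_simps)
      also have "(real (n0 - i) + real (j - Suc n1)) * \<alpha> \<le> real (j - i) * \<alpha>"
        using nonneg n0 n1 \<open>n0 \<le> n1\<close> by (intro mult_right_mono) auto
      finally show ?thesis by simp
    qed
  }
qed

text \<open>By 1 + a \<le> exp a, each step multiplies by at most exp a and adds one more
  \<open>b\<close>. For a = h L and b of order h^2 the bound is of order h as long as n h stays
  bounded.\<close>

lemma discrete_gronwall:
  fixes d :: "nat \<Rightarrow> real"
  assumes "d 0 = 0" "\<And>n. d (Suc n) \<le> (1 + a) * d n + b" "a \<ge> 0" "b \<ge> 0"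
  shows "d n \<le> real n * b * exp (real n * a)"
proof (induction n)
  case (Suc n)
  have "d (Suc n) \<le> (1 + a) * (real n * b * exp (real n * a)) + b"
    using assms(2)[of n] mult_left_mono[OF Suc.IH, of "1 + a"] assms(3) by linarith
  also have "\<dots> \<le> exp a * (real n * b * exp (real n * a)) + b * exp (real (Suc n) * a)"
    using assms(3,4) exp_ge_add_one_self[of a]
    by (intro add_mono mult_right_mono) (auto simp: mult_le_cancel_left1)
  also have "\<dots> = real (Suc n) * b * exp (real (Suc n) * a)"
    by (simp add: algebra_simps exp_add)
  finally show ?case .
qed (simp add: assms)

subsection \<open>Global solutions\<close>

text \<open>Comparison with the primitive of c exp (a t) for t \<ge> 0, and reflection for negative
  times. After division by exp (a |t|) it bounds a weighted sup norm, which Picard iteration needs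
  for boundedness and for contraction.\<close>

lemma norm_le_exp_of_derivative_le:
  fixes K :: "real \<Rightarrow> 'a::real_normed_vector"
  assumes "K 0 = 0" "\<And>s. (K has_vector_derivative K' s) (at s)"
    and "\<And>s. norm (K' s) \<le> c * exp (a * \<bar>s\<bar>)" "a > 0" "c \<ge> 0"
  shows "norm (K t) \<le> c / a * exp (a * \<bar>t\<bar>)"
proof -
  have pos: "norm (K t) \<le> c / a * exp (a * t)"
    if "t \<ge> 0" "K 0 = 0" and D: "\<And>s. (K has_vector_derivative K' s) (at s)"
      and le: "\<And>s. norm (K' s) \<le> c * exp (a * \<bar>s\<bar>)" for t and K K' :: "real \<Rightarrow> 'a"
  proof (cases "t = 0")
    case False
    have "norm (K t - K 0) \<le> c / a * exp (a * t) - c / a * exp (a * 0)"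
    proof (rule differentiable_bound_general)
      show "0 < t" using False that by auto
      show "continuous_on {0..t} K"
        using D by (meson continuous_at_imp_continuous_on has_vector_derivative_continuous)
      show "continuous_on {0..t} (\<lambda>s. c / a * exp (a * s))" by (intro continuous_intros)
      show "((\<lambda>s. c / a * exp (a * s)) has_vector_derivative c * exp (a * s)) (at s)" for s
        using \<open>a > 0\<close> unfolding has_real_derivative_iff_has_vector_derivative[symmetric]
        by (auto intro!: derivative_eq_intros)
      show "norm (K' s) \<le> c * exp (a * s)" if "0 < s" for s
        using le[of s] that by simp
    qed (rule D)
    moreover have "c / a \<ge> 0" using assms by simp
    ultimately show ?thesis using \<open>K 0 = 0\<close> by simp
  qed (use that assms in auto)
  show ?thesis
  proof (cases "t \<ge> 0")
    case True
    then show ?thesis using pos[OF _ assms(1-3)] by simp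
  next
    case False
    have "((\<lambda>s. K (- s)) has_vector_derivative - K' (- s)) (at s)" for s
    proof -
      have "(uminus has_vector_derivative (- 1 :: real)) (at s)"
        by (rule has_real_derivative_iff_has_vector_derivative[THEN iffD1, OF DERIV_minus[OF DERIV_ident]])
      from vector_diff_chain_at[OF this assms(2)] show ?thesis by (simp add: o_def)
    qed
    then have "norm (K (- (- t))) \<le> c / a * exp (a * (- t))"
      by (rule pos[rotated 2]) (use False assms(1) assms(3)[of "- _"] in auto)
    then show ?thesis using False by simp
  qed
qed

text \<open>Picard iteration, run on the whole line at once: measuring \<open>\<xi> - x\<close> in the
  norm weighted by \<open>exp (- 2 L \<bar>t\<bar>)\<close> makes the integral operator a contraction with factor one half.\<close>

lemma global_solution:
  fixes V :: "'a::euclidean_space \<Rightarrow> 'a"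
  assumes lip: "\<And>x y. norm (V x - V y) \<le> L * norm (x - y)" and "L > 0"
    and bnd: "\<And>x. norm (V x) \<le> B"
  obtains \<xi> where "\<xi> 0 = x" "\<And>t. (\<xi> has_vector_derivative V (\<xi> t)) (at t)"
proof -
  have "B \<ge> 0" by (rule order_trans[OF norm_ge_zero bnd])
  define E where "E t = exp (2 * L * \<bar>t\<bar>)" for t :: real
  have E: "E t > 0" for t by (simp add: E_def)
  have contE: "continuous_on UNIV E" unfolding E_def by (intro continuous_intros)
  \<comment> \<open>The unknown is \<open>g\<close>, standing for (\<xi> - x) / E, which is bounded
    even when \<xi> - x is not; \<open>P\<close> recovers \<xi>.\<close>
  define P where "P g t = x + E t *\<^sub>R apply_bcontfun g t" for g :: "real \<Rightarrow>\<^sub>C 'a" and t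
  have contV: "continuous_on UNIV V"
    using lip by (intro lipschitz_on_continuous_on[where L = L] lipschitz_onI)
      (auto simp: dist_norm less_imp_le[OF \<open>L > 0\<close>])
  have contP: "continuous_on UNIV (P g)" for g
    unfolding P_def by (intro continuous_intros contE) auto
  have "\<exists>F. F 0 = 0 \<and> (\<forall>t. (F has_vector_derivative V (P g t)) (at t))" for g
  proof -
    have "continuous_on UNIV (\<lambda>t. V (P g t))"
      using continuous_on_compose2[OF contV contP[of g]] by auto
    then have "isCont (\<lambda>t. V (P g t)) t" for t
      by (simp add: continuous_on_eq_continuous_at)
    then obtain F where F: "\<And>t. (F has_vector_derivative V (P g t)) (at t)"
      using einterval_antiderivative[of "-\<infinity>" "\<infinity>" "\<lambda>t. V (P g t)"] by auto
    have "((\<lambda>t. F t - F 0) has_vector_derivative V (P g t)) (at t)" for t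
      using has_vector_derivative_diff[OF F has_vector_derivative_const[of "F 0"]] by simp
    then show ?thesis by (intro exI[of _ "\<lambda>t. F t - F 0"]) auto
  qed
  then obtain J where J0: "\<And>g. J g 0 = 0"
    and J: "\<And>g t. (J g has_vector_derivative V (P g t)) (at t)" by metis
  define \<Phi> where "\<Phi> g = Bcontfun (\<lambda>t. inverse (E t) *\<^sub>R J g t)" for g
  have \<Phi>: "apply_bcontfun (\<Phi> g) = (\<lambda>t. inverse (E t) *\<^sub>R J g t)" for g
  proof -
    have "continuous_on UNIV (J g)"
      by (intro continuous_at_imp_continuous_on ballI has_vector_derivative_continuous[OF J])
    then have cont: "continuous_on UNIV (\<lambda>t. inverse (E t) *\<^sub>R J g t)"
      by (intro continuous_intros contE) (auto simp: E_def)
    have "norm (inverse (E t) *\<^sub>R J g t) \<le> B / (2 * L)" for t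
    proof -
      have "norm (V (P g s)) \<le> B * exp (2 * L * \<bar>s\<bar>)" for s
        using bnd[of "P g s"] \<open>L > 0\<close> \<open>B \<ge> 0\<close>
          mult_left_mono[of 1 "exp (2 * L * \<bar>s\<bar>)" B] by simp
      then have "norm (J g t) \<le> B / (2 * L) * E t"
        unfolding E_def using \<open>L > 0\<close> \<open>B \<ge> 0\<close>
        by (intro norm_le_exp_of_derivative_le[OF J0 J]) auto
      then show ?thesis using E[of t] by (simp add: field_simps)
    qed
    from bcontfun_normI[OF cont this] show ?thesis
      unfolding \<Phi>_def by (rule Bcontfun_inverse)
  qed
  \<comment> \<open>The rate 2 L in the weight against the Lipschitz constant L leaves the factor L
    / (2 L).\<close>
  have "dist (\<Phi> g) (\<Phi> h) \<le> 1 / 2 * dist g h" for g h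
  proof (rule dist_bound)
    fix t
    have le: "norm (V (P g s) - V (P h s)) \<le> L * dist g h * exp (2 * L * \<bar>s\<bar>)" for s
    proof -
      have "norm (P g s - P h s) = E s * dist (apply_bcontfun g s) (apply_bcontfun h s)"
        using E[of s] by (simp add: P_def dist_norm flip: scaleR_diff_right)
      also have "\<dots> \<le> E s * dist g h"
        using E[of s] by (intro mult_left_mono dist_bounded) auto
      finally have "L * norm (P g s - P h s) \<le> L * (E s * dist g h)"
        using \<open>L > 0\<close> by simp
      with lip[of "P g s" "P h s"] show ?thesis by (simp add: E_def mult_ac)
    qed
    have "norm (J g t - J h t) \<le> L * dist g h / (2 * L) * exp (2 * L * \<bar>t\<bar>)"
      using \<open>L > 0\<close>
      by (intro norm_le_exp_of_derivative_le[where K = "\<lambda>t. J g t - J h t"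
            and K' = "\<lambda>s. V (P g s) - V (P h s)"] has_vector_derivative_diff J le)
         (auto simp: J0)
    then have "norm (J g t - J h t) \<le> 1 / 2 * dist g h * E t"
      using \<open>L > 0\<close> by (simp add: E_def)
    then have "norm (inverse (E t) *\<^sub>R (J g t - J h t)) \<le> 1 / 2 * dist g h"
      using E[of t] unfolding norm_scaleR by (simp add: field_simps)
    then show "dist (apply_bcontfun (\<Phi> g) t) (apply_bcontfun (\<Phi> h) t) \<le> 1 / 2 * dist g h"
      by (simp add: \<Phi> dist_norm scaleR_diff_right)
  qed
  then obtain g where g: "\<Phi> g = g"
    using banach_fix_type[of "1/2" \<Phi>] by auto
  have "J g t = E t *\<^sub>R apply_bcontfun g t" for t
    using fun_cong[OF \<Phi>[of g], of t] E[of t] unfolding g by simp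
  then have "P g = (\<lambda>t. x + J g t)" by (auto simp: P_def)
  moreover have "((\<lambda>t. x + J g t) has_vector_derivative V (P g t)) (at t)" for t
    using has_vector_derivative_add[OF has_vector_derivative_const J] by simp
  ultimately show ?thesis
    using that[of "\<lambda>t. x + J g t"] by (simp add: J0)
qed

subsection \<open>The stream function\<close>

text \<open>Cut the translated square at coordinate 1: the overhang, moved back by the lattice
  vector \<open>axis i 1\<close>, fills the strip that the translation vacated.\<close>

lemma integral_cbox_translate_axis:
  fixes f :: "real^2 \<Rightarrow> 'b::euclidean_space"
  assumes cont: "continuous_on UNIV f" and per: "Z2_periodic f" and t: "0 \<le> t" "t \<le> 1"
  shows "integral (cbox 0 1) (\<lambda>x. f (x + t *\<^sub>R axis i 1)) = integral (cbox 0 1) f"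
proof -
  define e :: "real^2" where "e = axis i 1"
  have e: "e \<in> Basis" "e \<in> Z2"
    unfolding e_def by (simp_all add: axis_in_Basis_iff) (simp add: Z2_def axis_def)
  have e_nth: "e $ j = (if j = i then 1 else 0)" for j by (simp add: e_def axis_def)
  have inner_e: "x \<bullet> e = x $ i" for x by (simp add: e_def inner_axis)
  have mem: "x \<in> cbox a b \<longleftrightarrow> a $ i \<le> x $ i \<and> x $ i \<le> b $ i \<and>
      (\<forall>j. j \<noteq> i \<longrightarrow> a $ j \<le> x $ j \<and> x $ j \<le> b $ j)" for x a b :: "real^2"
    unfolding mem_box_cart by metis
  have int: "f integrable_on cbox a b" for a b
    by (rule integrable_continuous) (rule continuous_on_subset[OF cont], simp)
  have shift: "integral (cbox a b) (\<lambda>x. f (x + c)) = integral (cbox (a + c) (b + c)) f" for a b c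
    using integral_shift_cbox_plus[of a b f c] by (simp add: o_def add.commute)
  have "integral (cbox 0 1) (\<lambda>x. f (x + t *\<^sub>R e)) = integral (cbox (t *\<^sub>R e) (1 + t *\<^sub>R e)) f"
    by (simp add: shift)
  also have "\<dots> = integral (cbox (t *\<^sub>R e) (1 + t *\<^sub>R e) \<inter> {x. x \<bullet> e \<le> 1}) f +
      integral (cbox (t *\<^sub>R e) (1 + t *\<^sub>R e) \<inter> {x. x \<bullet> e \<ge> 1}) f"
    by (rule integral_split[OF int e(1)])
  also have "cbox (t *\<^sub>R e) (1 + t *\<^sub>R e) \<inter> {x. x \<bullet> e \<le> 1} = cbox (t *\<^sub>R e) 1"
    using t by (auto simp: mem inner_e e_nth)
  also have "cbox (t *\<^sub>R e) (1 + t *\<^sub>R e) \<inter> {x. x \<bullet> e \<ge> 1} = cbox (0 + e) ((1 + (t - 1) *\<^sub>R e) + e)"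
    using t by (auto simp: mem inner_e e_nth)
  also have "integral \<dots> f = integral (cbox 0 (1 + (t - 1) *\<^sub>R e)) f"
    unfolding shift[symmetric] by (simp add: Z2_periodicD[OF per e(2)])
  also have "cbox 0 (1 + (t - 1) *\<^sub>R e) = cbox 0 1 \<inter> {x. x \<bullet> e \<le> t}"
    using t by (auto simp: mem inner_e e_nth)
  also have "cbox (t *\<^sub>R e) 1 = cbox 0 1 \<inter> {x. x \<bullet> e \<ge> t}"
    using t by (auto simp: mem inner_e e_nth)
  also have "integral (cbox 0 1 \<inter> {x. x \<bullet> e \<ge> t}) f + integral (cbox 0 1 \<inter> {x. x \<bullet> e \<le> t}) f =
      integral (cbox 0 1) f"
    using integral_split[OF int e(1), of 0 1 t] by simp
  finally show ?thesis by (simp add: e_def)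
qed

definition perp :: "real^2 \<Rightarrow> real^2" where
  "perp a = (\<chi> i. if i = 1 then - a $ 2 else a $ 1)"

text \<open>The determinant with columns \<open>a\<close> and \<open>b\<close>; as an inner product
  it is visibly a bounded functional of \<open>b\<close>.\<close>

definition cr :: "real^2 \<Rightarrow> real^2 \<Rightarrow> real" where
  "cr a b = perp a \<bullet> b"

lemma cr_eq: "cr a b = a $ 1 * b $ 2 - a $ 2 * b $ 1"
  by (simp add: cr_def perp_def inner_vec_def sum_2)

lemma bounded_linear_perp: "bounded_linear perp"
  unfolding linear_conv_bounded_linear[symmetric]
  by (rule linearI) (auto simp: perp_def vec_eq_iff)

lemma bounded_bilinear_cr: "bounded_bilinear cr"
  unfolding cr_def by (rule bounded_bilinear.comp1[OF bounded_bilinear_inner bounded_linear_perp])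

lemma cr_self [simp]: "cr a a = 0"
  by (simp add: cr_eq)

text \<open>The one-form \<open>cr V\<close> is closed because \<open>V\<close> is divergence free; this is its primitive
  along rays from the origin.\<close>

definition stream :: "(real^2 \<Rightarrow> real^2) \<Rightarrow> real^2 \<Rightarrow> real" where
  "stream V x = integral {0..1} (\<lambda>t. cr (V (t *\<^sub>R x)) x)"

text \<open>The two sides differ by the trace of the derivative times \<open>cr u w\<close>, and the
  trace is the divergence.\<close>

lemma cr_derivative_commute:
  assumes "C_infty V" "divergence V x = 0"
  shows "cr (frechet_derivative V (at x) u) w = cr (frechet_derivative V (at x) w) u"
proof -
  let ?D = "frechet_derivative V (at x)"
  have lin: "linear ?D"
    by (rule has_derivative_linear[OF C_infty_imp_has_derivative[OF assms(1)]])
  have "?D v = v $ 1 *\<^sub>R ?D (axis 1 1) + v $ 2 *\<^sub>R ?D (axis 2 1)" for v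
  proof -
    have "v = v $ 1 *\<^sub>R axis 1 1 + v $ 2 *\<^sub>R axis 2 1"
      by (auto simp: vec_eq_iff axis_def forall_2)
    then have "?D v = ?D (v $ 1 *\<^sub>R axis 1 1 + v $ 2 *\<^sub>R axis 2 1)" by simp
    then show ?thesis by (simp add: linear_add[OF lin] linear_scale[OF lin])
  qed
  note D = this[of u] this[of w]
  have tr: "?D (axis 2 1) $ 2 = - ?D (axis 1 1) $ 1"
    using assms(2) by (simp add: divergence_def sum_2)
  show ?thesis
    unfolding cr_eq D by (simp add: tr algebra_simps)
qed

text \<open>Differentiating under the integral puts the direction u into both slots of
  \<open>cr\<close>. Commuting moves it out of the derivative of \<open>V\<close>; what remains is
  cr (W x t) u, where \<open>W x t\<close> is the t-derivative of t V(t x), so the integral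
  collapses to cr (V x) u.\<close>

lemma stream_has_derivative:
  assumes V: "C_infty V" and div: "\<And>x. divergence V x = 0"
  shows "(stream V has_derivative cr (V x)) (at x)"
proof -
  let ?D = "\<lambda>x. frechet_derivative V (at x)"
  have DV: "(V has_derivative ?D x) (at x)" for x
    by (rule C_infty_imp_has_derivative[OF V])
  interpret cr: bounded_bilinear cr by (rule bounded_bilinear_cr)
  define W where "W x t = t *\<^sub>R ?D (t *\<^sub>R x) x + V (t *\<^sub>R x)" for x t
  have D_sum: "?D y x = (\<Sum>b\<in>Basis. (x \<bullet> b) *\<^sub>R ?D y b)" for x y
    by (rule linear_eq_sum_Basis[OF has_derivative_bounded_linear[OF DV]])
  have contV: "continuous_on UNIV V" by (rule C_infty_imp_continuous_on[OF V])
  have contD: "continuous_on UNIV (\<lambda>x. ?D x b)" for b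
    by (rule C_infty_imp_continuous_on[OF C_infty_frechet_derivative[OF V]])
  have contW: "continuous_on UNIV (\<lambda>(x, t). W x t)"
    unfolding W_def case_prod_beta
    by (subst D_sum)
       (intro continuous_intros continuous_on_compose2[OF contV] continuous_on_compose2[OF contD];
         simp)
  define fx where "fx x t = blinfun_inner_right (perp (W x t))" for x t
  have fx: "blinfun_apply (fx x t) = cr (W x t)" for x t
    by (auto simp: fx_def cr_def)
  have contfx: "continuous_on UNIV (\<lambda>(x, t). fx x t)"
    unfolding fx_def case_prod_beta
    by (intro bounded_linear.continuous_on[OF bounded_linear_blinfun_inner_right]
        bounded_linear.continuous_on[OF bounded_linear_perp] contW[unfolded case_prod_beta])
  have "(stream V has_derivative blinfun_apply (integral (cbox 0 1) (fx x))) (at x within UNIV)"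
    unfolding stream_def cbox_interval[symmetric]
  proof (rule leibniz_rule[where fx = fx])
    fix x t
    have "((\<lambda>x. V (t *\<^sub>R x)) has_derivative (\<lambda>u. ?D (t *\<^sub>R x) (t *\<^sub>R u))) (at x)"
      by (rule has_derivative_compose[OF _ DV]) (auto intro!: derivative_eq_intros)
    from cr.FDERIV[OF this has_derivative_ident]
    have "((\<lambda>x. cr (V (t *\<^sub>R x)) x) has_derivative
        (\<lambda>u. cr (V (t *\<^sub>R x)) u + cr (?D (t *\<^sub>R x) (t *\<^sub>R u)) x)) (at x)" .
    also have "(\<lambda>u. cr (V (t *\<^sub>R x)) u + cr (?D (t *\<^sub>R x) (t *\<^sub>R u)) x) = cr (W x t)"
      using linear_scale[OF has_derivative_linear[OF DV]]
      by (auto simp: W_def cr.add_left cr.scaleR_left cr_derivative_commute[OF V div, of _ _ x])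
    finally show "((\<lambda>x. cr (V (t *\<^sub>R x)) x) has_derivative blinfun_apply (fx x t)) (at x within UNIV)"
      by (simp add: fx)
  next
    show "(\<lambda>t. cr (V (t *\<^sub>R x)) x) integrable_on cbox 0 1" for x
      by (intro integrable_continuous cr.continuous_on continuous_intros
          continuous_on_compose2[OF contV]) auto
    show "continuous_on (UNIV \<times> cbox 0 1) (\<lambda>(x, t). fx x t)"
      by (rule continuous_on_subset[OF contfx]) auto
  qed auto
  moreover have "blinfun_apply (integral (cbox 0 1) (fx x)) = cr (V x)"
  proof
    fix u
    have "continuous_on (cbox 0 1) (fx x)"
      using continuous_on_compose2[OF contfx, of "cbox 0 1" "\<lambda>t. (x, t)"]
      by (simp add: continuous_on_Pair)
    then have "blinfun_apply (integral (cbox 0 1) (fx x)) u = integral (cbox 0 1) (\<lambda>t. cr (W x t) u)"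
      by (simp add: blinfun_apply_integral integrable_continuous_interval fx)
    also have "((\<lambda>t. cr (W x t) u) has_integral (1 * cr (V (1 *\<^sub>R x)) u - 0 * cr (V (0 *\<^sub>R x)) u)) {0..1}"
    proof (rule fundamental_theorem_of_calculus)
      fix t :: real
      have "((\<lambda>t. V (t *\<^sub>R x)) has_derivative (\<lambda>s. ?D (t *\<^sub>R x) (s *\<^sub>R x))) (at t)"
        by (rule has_derivative_compose[OF _ DV]) (auto intro!: derivative_eq_intros)
      then have "((\<lambda>t. V (t *\<^sub>R x)) has_derivative (\<lambda>s. s *\<^sub>R ?D (t *\<^sub>R x) x)) (at t)"
        using linear_scale[OF has_derivative_linear[OF DV]] by simp
      from has_derivative_mult[OF has_derivative_ident cr.FDERIV[OF this has_derivative_const]]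
      have "((\<lambda>t. t * cr (V (t *\<^sub>R x)) u) has_derivative
          (\<lambda>s. t * (cr (V (t *\<^sub>R x)) 0 + cr (s *\<^sub>R ?D (t *\<^sub>R x) x) u) + s * cr (V (t *\<^sub>R x)) u)) (at t)" .
      then have "((\<lambda>t. t * cr (V (t *\<^sub>R x)) u) has_vector_derivative cr (W x t) u) (at t)"
        unfolding has_vector_derivative_def
        by (rule has_derivative_eq_rhs)
           (auto simp: W_def cr.zero_right cr.add_left cr.scaleR_left algebra_simps)
      then show "((\<lambda>t. t * cr (V (t *\<^sub>R x)) u) has_vector_derivative cr (W x t) u) (at t within {0..1})"
        by (rule has_vector_derivative_at_within)
    qed simp
    then have "integral (cbox 0 1) (\<lambda>t. cr (W x t) u) = cr (V x) u"
      by (simp add: integral_unique)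
    finally show "blinfun_apply (integral (cbox 0 1) (fx x)) u = cr (V x) u" .
  qed
  ultimately show ?thesis by simp
qed


text \<open>As \<open>V\<close> is periodic, the increment over a lattice generator e is a constant
  c, the flux of \<open>V\<close> through any unit segment parallel to e. Averaging over all
  segments that start in the unit square and swapping integrals turns c into
  \<open>cr (mean_torus V) e\<close>, which is zero.\<close>

lemma stream_periodic:
  assumes V: "C_infty V" and per: "Z2_periodic V" and div: "\<And>x. divergence V x = 0"
    and mean: "mean_torus V = 0"
  shows "Z2_periodic (stream V)"
proof -
  interpret cr: bounded_bilinear cr by (rule bounded_bilinear_cr)
  have contV: "continuous_on UNIV V" by (rule C_infty_imp_continuous_on[OF V])
  note DH = stream_has_derivative[OF V div]
  have axis: "stream V (x + axis i 1) = stream V x" for x i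
  proof -
    define e :: "real^2" where "e = axis i 1"
    have e: "e \<in> Z2" by (simp add: e_def Z2_def axis_def)
    have "((\<lambda>x. stream V (x + e) - stream V x) has_derivative (\<lambda>h. 0)) (at x within UNIV)" for x
    proof -
      have "((\<lambda>x. stream V (x + e)) has_derivative cr (V (x + e))) (at x)"
        by (rule has_derivative_compose[OF _ DH, where f' = "\<lambda>v. v"])
           (auto intro!: derivative_eq_intros)
      from has_derivative_diff[OF this DH] show ?thesis
        by (simp add: Z2_periodicD[OF per e])
    qed
    then obtain c where c: "\<And>x. stream V (x + e) - stream V x = c"
      using has_derivative_zero_constant[of UNIV "\<lambda>x. stream V (x + e) - stream V x"] by auto
    have line: "integral (cbox 0 1) (\<lambda>t. cr (V (x + t *\<^sub>R e)) e) = c" for x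
    proof -
      have "((\<lambda>t. cr (V (x + t *\<^sub>R e)) e) has_integral
          stream V (x + 1 *\<^sub>R e) - stream V (x + 0 *\<^sub>R e)) {0..1}"
      proof (rule fundamental_theorem_of_calculus)
        fix t :: real
        have "((\<lambda>t. stream V (x + t *\<^sub>R e)) has_derivative (\<lambda>s. cr (V (x + t *\<^sub>R e)) (s *\<^sub>R e))) (at t)"
          by (rule has_derivative_compose[OF _ DH]) (auto intro!: derivative_eq_intros)
        then have "((\<lambda>t. stream V (x + t *\<^sub>R e)) has_vector_derivative cr (V (x + t *\<^sub>R e)) e) (at t)"
          by (simp add: has_vector_derivative_def cr.scaleR_right)
        then show "((\<lambda>t. stream V (x + t *\<^sub>R e)) has_vector_derivative cr (V (x + t *\<^sub>R e)) e)
            (at t within {0..1})"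
          by (rule has_vector_derivative_at_within)
      qed simp
      then show ?thesis by (simp add: integral_unique c)
    qed
    have cont: "continuous_on S (\<lambda>(x, t). cr (V (x + t *\<^sub>R e)) e)" for S
      unfolding case_prod_beta
      by (intro cr.continuous_on continuous_intros continuous_on_compose2[OF contV]) auto
    have "c = integral (cbox 0 (1 :: real^2)) (\<lambda>x. c)"
      by (simp add: content_cbox_cart interval_eq_empty_cart)
    also have "\<dots> = integral (cbox 0 1) (\<lambda>x. integral (cbox 0 1) (\<lambda>t. cr (V (x + t *\<^sub>R e)) e))"
      by (simp only: line)
    also have "\<dots> = integral (cbox 0 1) (\<lambda>t. integral (cbox 0 1) (\<lambda>x. cr (V (x + t *\<^sub>R e)) e))"
      by (rule integral_swap_continuous[OF cont])
    also have "\<dots> = integral (cbox 0 (1 :: real)) (\<lambda>t. 0)"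
    proof (rule integral_cong)
      fix t :: real assume t: "t \<in> cbox 0 1"
      have "(\<lambda>x. V (x + t *\<^sub>R e)) integrable_on cbox 0 1"
        by (intro integrable_continuous continuous_intros continuous_on_compose2[OF contV]) auto
      from integral_linear[OF this cr.bounded_linear_left, of e]
      have "integral (cbox 0 1) (\<lambda>x. cr (V (x + t *\<^sub>R e)) e) =
          cr (integral (cbox 0 1) (\<lambda>x. V (x + t *\<^sub>R e))) e"
        by (simp add: o_def)
      also have "integral (cbox 0 1) (\<lambda>x. V (x + t *\<^sub>R e)) = 0"
        using integral_cbox_translate_axis[OF contV per, of t i] t mean
        by (simp add: e_def mean_torus_def)
      finally show "integral (cbox 0 1) (\<lambda>x. cr (V (x + t *\<^sub>R e)) e) = 0"
        by (simp add: cr.zero_left)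
    qed
    finally show ?thesis using c[of x] by (simp add: e_def)
  qed
  have nat_axis: "stream V (x + real n *\<^sub>R axis i 1) = stream V x" for x i n
  proof (induction n)
    case (Suc n)
    then show ?case
      using axis[of "x + real n *\<^sub>R axis i 1" i] by (simp add: algebra_simps)
  qed simp
  have int_axis: "stream V (x + of_int n *\<^sub>R axis i 1) = stream V x" for x i n
  proof (cases n rule: int_cases2)
    case (nonneg m)
    then show ?thesis using nat_axis by simp
  next
    case (nonpos m)
    then show ?thesis using nat_axis[of "x - real m *\<^sub>R axis i 1" m i] by simp
  qed
  show ?thesis
    unfolding Z2_periodic_def
  proof (intro allI ballI)
    fix x k :: "real^2" assume "k \<in> Z2"
    then obtain m n where "k $ 1 = of_int m" "k $ 2 = of_int n"
      unfolding Z2_def Ints_def by blast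
    then have "k = of_int m *\<^sub>R axis 1 1 + of_int n *\<^sub>R axis 2 1"
      by (auto simp: vec_eq_iff axis_def forall_2)
    then show "stream V (x + k) = stream V x"
      using int_axis by (simp flip: add.assoc)
  qed
qed

subsection \<open>Flow boxes and drift\<close>

text \<open>The constants come from compactness of the torus. \<open>M\<close>, a Lipschitz constant
  of the derivative, controls the Taylor remainders of the Euler scheme.\<close>

locale torus_flow =
  fixes V :: "real^2 \<Rightarrow> real^2" and L B M :: real
  assumes smooth: "C_infty V" and per: "Z2_periodic V"
    and div: "\<And>x. divergence V x = 0" and mean: "mean_torus V = 0"
    and pos: "L > 0" "B > 0" "M > 0"
    and lip: "\<And>x y. norm (V x - V y) \<le> L * norm (x - y)"
    and bnd: "\<And>x. norm (V x) \<le> B"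
    and deriv_le: "\<And>x v. norm (frechet_derivative V (at x) v) \<le> L * norm v"
    and deriv_lip: "\<And>x y v. norm (frechet_derivative V (at x) v - frechet_derivative V (at y) v)
      \<le> M * norm (x - y) * norm v"
begin

lemma orbit_deriv: "orbit V \<xi> \<Longrightarrow> (\<xi> has_vector_derivative V (\<xi> t)) (at t)"
  by (simp add: orbit_def)

lemma orbit_shift:
  assumes "orbit V \<xi>"
  shows "orbit V (\<lambda>t. \<xi> (a + t))"
proof (rule orbitI[OF smooth])
  fix t
  have "((\<lambda>t. a + t) has_vector_derivative 1) (at t)"
    unfolding has_real_derivative_iff_has_vector_derivative[symmetric]
    by (auto intro!: derivative_eq_intros)
  from vector_diff_chain_at[OF this orbit_deriv[OF assms]]
  show "((\<lambda>t. \<xi> (a + t)) has_vector_derivative V (\<xi> (a + t))) (at t)"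
    by (simp add: o_def)
qed

text \<open>Mean value inequality for \<xi> u - u w. With w = 0 it bounds displacement by speed;
  with w the initial velocity it is the local error of an Euler step.\<close>

lemma orbit_deviation:
  assumes "orbit V \<xi>" and le: "\<And>u. u \<in> closed_segment s t \<Longrightarrow> norm (V (\<xi> u) - w) \<le> c"
  shows "norm (\<xi> t - \<xi> s - (t - s) *\<^sub>R w) \<le> c * \<bar>t - s\<bar>"
proof -
  have "norm ((\<xi> t - t *\<^sub>R w) - (\<xi> s - s *\<^sub>R w)) \<le> c * norm (t - s)"
  proof (rule differentiable_bound[where S = "closed_segment s t"
        and f' = "\<lambda>u v. v *\<^sub>R (V (\<xi> u) - w)"])
    fix u assume u: "u \<in> closed_segment s t"
    have "((\<lambda>u. \<xi> u - u *\<^sub>R w) has_vector_derivative V (\<xi> u) - 1 *\<^sub>R w) (at u)"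
      by (intro has_vector_derivative_diff orbit_deriv[OF assms(1)])
         (auto intro!: derivative_eq_intros simp: has_vector_derivative_def)
    then show "((\<lambda>u. \<xi> u - u *\<^sub>R w) has_derivative (\<lambda>v. v *\<^sub>R (V (\<xi> u) - w)))
        (at u within closed_segment s t)"
      by (simp add: has_vector_derivative_def has_derivative_at_withinI)
    show "onorm (\<lambda>v. v *\<^sub>R (V (\<xi> u) - w)) \<le> c"
      using mult_left_mono[OF le[OF u] abs_ge_zero] by (intro onorm_le) (simp add: mult.commute)
  qed auto
  moreover have "(\<xi> t - t *\<^sub>R w) - (\<xi> s - s *\<^sub>R w) = \<xi> t - \<xi> s - (t - s) *\<^sub>R w"
    by (simp add: algebra_simps)
  ultimately show ?thesis by simp
qed

lemma orbit_lipschitz: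
  assumes "orbit V \<xi>"
  shows "norm (\<xi> t - \<xi> s) \<le> B * \<bar>t - s\<bar>"
  using orbit_deviation[OF assms, of s t 0 B] bnd by simp

lemma stream_orbit:
  assumes "orbit V \<xi>"
  shows "stream V (\<xi> t) = stream V (\<xi> s)"
proof -
  interpret cr: bounded_bilinear cr by (rule bounded_bilinear_cr)
  have "((\<lambda>t. stream V (\<xi> t)) has_derivative (\<lambda>h. 0)) (at t within UNIV)" for t
    using has_derivative_compose[OF orbit_deriv[OF assms, of t, unfolded has_vector_derivative_def]
        stream_has_derivative[OF smooth div]]
    by (simp add: cr.scaleR_right)
  then show ?thesis
    using has_derivative_zero_constant[of UNIV "\<lambda>t. stream V (\<xi> t)"] by auto
qed

text \<open>Near \<open>\<xi> t\<close> every velocity has a positive component along v = V (\<xi>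
  t), so the orbit sweeps the coordinate along v and reaches that of \<open>z\<close> at some time
  s. The remaining gap d is orthogonal to v. Its ends lie on one level set, so \<open>V\<close> is
  parallel to d somewhere in between, which contradicts the alignment unless d = 0.\<close>

lemma flow_box:
  assumes \<xi>: "orbit V \<xi>" and fast: "norm (V (\<xi> t)) \<ge> \<delta>" and "\<delta> > 0" "\<tau> > 0"
    and small: "2 * L * B * \<tau> \<le> \<delta>" "2 * norm (z - \<xi> t) \<le> \<tau> * \<delta>"
    and level: "stream V z = stream V (\<xi> t)"
  shows "\<exists>s. \<bar>s\<bar> \<le> \<tau> \<and> z = \<xi> (t + s)"
proof -
  define v where "v = V (\<xi> t)"
  have v: "norm v \<ge> \<delta>" "norm v \<le> B" "norm v > 0"
    using fast bnd \<open>\<delta> > 0\<close> by (auto simp: v_def)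
  \<comment> \<open>\<open>2 * L * B * \<tau> \<le> \<delta>\<close> keeps \<open>V\<close> within
    |v| / 2 of v on the ball of radius B \<tau>, which contains the orbit arc for times up to
    \<tau>.\<close>
  have aligned: "v \<bullet> V w \<ge> (norm v)\<^sup>2 / 2" if "norm (w - \<xi> t) \<le> B * \<tau>" for w
  proof -
    have "norm (V w - v) \<le> L * norm (w - \<xi> t)" unfolding v_def by (rule lip)
    also have "\<dots> \<le> L * (B * \<tau>)" using that pos by (intro mult_left_mono) auto
    also have "\<dots> \<le> norm v / 2" using small v by (simp add: mult.assoc)
    finally have "\<bar>v \<bullet> (V w - v)\<bar> \<le> norm v * (norm v / 2)"
      using Cauchy_Schwarz_ineq2[of v "V w - v"] by (meson mult_left_mono norm_ge_zero order_trans)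
    moreover have "v \<bullet> (V w - v) = v \<bullet> V w - norm v * norm v"
      by (simp add: inner_diff_right norm_eq_sqrt_inner)
    ultimately have "\<bar>v \<bullet> V w - norm v * norm v\<bar> \<le> norm v * norm v / 2" by simp
    then show ?thesis unfolding power2_eq_square by linarith
  qed
  define g where "g s = v \<bullet> (\<xi> (t + s) - \<xi> t)" for s
  have near: "norm (\<xi> (t + s) - \<xi> t) \<le> B * \<tau>" if "\<bar>s\<bar> \<le> \<tau>" for s
  proof -
    have "norm (\<xi> (t + s) - \<xi> t) \<le> B * \<bar>s\<bar>" using orbit_lipschitz[OF \<xi>, of "t + s" t] by simp
    also have "\<dots> \<le> B * \<tau>" using that pos by (intro mult_left_mono) auto
    finally show ?thesis .
  qed
  have g': "(g has_real_derivative v \<bullet> V (\<xi> (t + s))) (at s)" for s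
    unfolding g_def has_real_derivative_iff_has_vector_derivative
    using bounded_linear.has_vector_derivative[OF bounded_linear_inner_right
        has_vector_derivative_diff[OF orbit_deriv[OF orbit_shift[OF \<xi>]] has_vector_derivative_const]]
    by simp
  have step: "g b - g a \<ge> (b - a) * ((norm v)\<^sup>2 / 2)" if "- \<tau> \<le> a" "a < b" "b \<le> \<tau>" for a b
  proof -
    obtain c where c: "a < c" "c < b" "g b - g a = (b - a) * (v \<bullet> V (\<xi> (t + c)))"
      using MVT2[OF \<open>a < b\<close> g'] by blast
    have "v \<bullet> V (\<xi> (t + c)) \<ge> (norm v)\<^sup>2 / 2"
      using c that by (intro aligned near) auto
    then show ?thesis using c that by (simp add: mult_left_mono)
  qed
  have g0: "g 0 = 0" by (simp add: g_def)
  have "\<bar>v \<bullet> (z - \<xi> t)\<bar> \<le> norm v * norm (z - \<xi> t)" by (rule Cauchy_Schwarz_ineq2)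
  also have "\<dots> \<le> norm v * (\<tau> * norm v / 2)"
    using small(2) mult_left_mono[OF v(1), of \<tau>] \<open>\<tau> > 0\<close>
    by (intro mult_left_mono) (linarith, simp)
  finally have z: "\<bar>v \<bullet> (z - \<xi> t)\<bar> \<le> \<tau> * ((norm v)\<^sup>2 / 2)" by (simp add: power2_eq_square mult_ac)
  have "g (- \<tau>) \<le> v \<bullet> (z - \<xi> t)" "v \<bullet> (z - \<xi> t) \<le> g \<tau>"
    using step[of "- \<tau>" 0] step[of 0 \<tau>] z g0 \<open>\<tau> > 0\<close> by auto
  moreover have "continuous_on {- \<tau>..\<tau>} g"
    by (intro continuous_at_imp_continuous_on ballI DERIV_isCont[OF g'])
  ultimately obtain s where s: "- \<tau> \<le> s" "s \<le> \<tau>" "g s = v \<bullet> (z - \<xi> t)"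
    using IVT'[of g "- \<tau>" "v \<bullet> (z - \<xi> t)" \<tau>] \<open>\<tau> > 0\<close> by auto
  define d where "d = z - \<xi> (t + s)"
  have vd: "v \<bullet> d = 0" using s(3) by (simp add: d_def g_def inner_diff_right)
  have "((\<lambda>\<theta>. stream V (\<xi> (t + s) + \<theta> *\<^sub>R d)) has_real_derivative cr (V (\<xi> (t + s) + \<theta> *\<^sub>R d)) d) (at \<theta>)"
    for \<theta>
  proof -
    have "((\<lambda>\<theta>. stream V (\<xi> (t + s) + \<theta> *\<^sub>R d)) has_derivative
        (\<lambda>h. cr (V (\<xi> (t + s) + \<theta> *\<^sub>R d)) (h *\<^sub>R d))) (at \<theta>)"
      by (rule has_derivative_compose[OF _ stream_has_derivative[OF smooth div]])
         (auto intro!: derivative_eq_intros)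
    then show ?thesis
      unfolding has_real_derivative_iff_has_vector_derivative has_vector_derivative_def
      by (simp add: bounded_bilinear.scaleR_right[OF bounded_bilinear_cr])
  qed
  from MVT2[OF zero_less_one this] obtain \<theta> where \<theta>: "0 < \<theta>" "\<theta> < 1"
    and "stream V (\<xi> (t + s) + 1 *\<^sub>R d) - stream V (\<xi> (t + s) + 0 *\<^sub>R d) =
      (1 - 0) * cr (V (\<xi> (t + s) + \<theta> *\<^sub>R d)) d" by blast
  moreover define w where "w = \<xi> (t + s) + \<theta> *\<^sub>R d"
  ultimately have crd: "cr (V w) d = 0"
    using stream_orbit[OF \<xi>, of "t + s" t] level by (simp add: d_def)
  have "w = (1 - \<theta>) *\<^sub>R \<xi> (t + s) + \<theta> *\<^sub>R z"
    by (simp add: w_def d_def algebra_simps)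
  moreover have "\<tau> * \<delta> \<le> \<tau> * B" using v \<open>\<tau> > 0\<close> by (intro mult_left_mono) auto
  then have "norm (z - \<xi> t) \<le> B * \<tau>"
    using small(2) norm_ge_zero[of "z - \<xi> t"] unfolding mult.commute[of B] by linarith
  moreover have "norm (\<xi> (t + s) - \<xi> t) \<le> B * \<tau>"
    using s by (intro near) auto
  ultimately have "w \<in> cball (\<xi> t) (B * \<tau>)"
    using convexD_alt[OF convex_cball, of "\<xi> (t + s)" "\<xi> t" "B * \<tau>" z \<theta>] \<theta>
    by (simp add: dist_norm norm_minus_commute)
  then have "(norm v)\<^sup>2 / 2 \<le> v \<bullet> V w"
    by (intro aligned) (simp add: dist_norm norm_minus_commute)
  moreover have "(norm v)\<^sup>2 > 0" using v by simp
  ultimately have "v \<bullet> V w > 0" by linarith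
  \<comment> \<open>Cramer's rule: as linear forms in d, \<open>v \<bullet> d\<close> and
    \<open>cr (V w) d\<close> have determinant \<open>v \<bullet> V w\<close>.\<close>
  moreover have "d $ 1 * (v \<bullet> V w) = V w $ 1 * (v \<bullet> d) - v $ 2 * cr (V w) d"
    "d $ 2 * (v \<bullet> V w) = V w $ 2 * (v \<bullet> d) + v $ 1 * cr (V w) d"
    by (simp_all add: cr_eq inner_vec_def sum_2 algebra_simps)
  ultimately have "d = 0"
    using vd crd by (simp add: vec_eq_iff forall_2)
  then show ?thesis
    using s by (intro exI[of _ s]) (auto simp: d_def)
qed

end

definition cell :: "nat \<Rightarrow> real^2 \<Rightarrow> int \<times> int" where
  "cell m x = (\<lfloor>real m * frac (x $ 1)\<rfloor>, \<lfloor>real m * frac (x $ 2)\<rfloor>)"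

lemma cell_range:
  assumes "m > 0"
  shows "cell m x \<in> {0..<int m} \<times> {0..<int m}"
proof -
  have "0 \<le> real m * frac a" "real m * frac a < real m" for a :: real
    using assms frac_lt_1[of a] by auto
  then show ?thesis by (simp add: cell_def floor_less_iff)
qed

lemma cell_eq_imp_near:
  assumes "m > 0" "cell m x = cell m y"
  obtains k where "k \<in> Z2" "norm (x - k - y) \<le> 2 / real m"
proof
  define k :: "real^2" where "k = (\<chi> i. of_int (\<lfloor>x $ i\<rfloor> - \<lfloor>y $ i\<rfloor>))"
  show "k \<in> Z2" by (simp add: k_def Z2_def)
  have near: "\<bar>frac a - frac b\<bar> \<le> 1 / real m"
    if "\<lfloor>real m * frac a\<rfloor> = \<lfloor>real m * frac b\<rfloor>" for a b :: real
  proof -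
    have "\<bar>real m * frac a - real m * frac b\<bar> \<le> 1" using that by linarith
    then have "real m * \<bar>frac a - frac b\<bar> \<le> 1"
      by (simp add: abs_mult flip: right_diff_distrib)
    then show ?thesis using assms by (simp add: field_simps)
  qed
  have comp: "(x - k - y) $ i = frac (x $ i) - frac (y $ i)" for i
    by (simp add: k_def frac_def)
  have "norm (x - k - y) \<le> \<bar>(x - k - y) $ 1\<bar> + \<bar>(x - k - y) $ 2\<bar>"
    using norm_le_l1_cart[of "x - k - y"] by (simp add: sum_2)
  also have "\<dots> \<le> 1 / real m + 1 / real m"
    using assms(2) unfolding comp cell_def by (intro add_mono near) auto
  finally show "norm (x - k - y) \<le> 2 / real m" by simp
qed

section \<open>Returns of an orbit and the linear drift bound\<close>

context torus_flow
begin

text \<open>Shifted back by \<open>k\<close>, the returned point has the stream value of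
  \<open>\<xi> s\<close> and lies within 2 / m of it, so it sits on the arc through
  \<open>\<xi> s\<close>: \<xi> t = \<xi> (s + u) + k. From time s + u on the orbit is periodic and
  gains nothing; only the piece of duration |u| \<le> \<tau> is left to pay.\<close>

lemma periodic_orbit_near_return:
  assumes \<xi>: "orbit V \<xi>" and fast: "norm (V (\<xi> s)) \<ge> \<delta>" and "\<delta> > 0" "\<tau> > 0"
    and small: "2 * L * B * \<tau> \<le> \<delta>" "4 / real m \<le> \<tau> * \<delta>" and "m > 0"
    and return: "s + \<tau> \<le> t" "cell m (\<xi> s) = cell m (\<xi> t)"
    and no_drift: "\<And>\<zeta> T. periodic_orbit V \<zeta> T \<Longrightarrow> p \<bullet> (\<zeta> T - \<zeta> 0) \<le> 0"
  shows "p \<bullet> (\<xi> t - \<xi> s) \<le> norm p * (B * \<tau>)"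
proof -
  obtain k where k: "k \<in> Z2" "norm (\<xi> t - k - \<xi> s) \<le> 2 / real m"
    using cell_eq_imp_near[OF \<open>m > 0\<close> return(2)[symmetric]] by blast
  have "stream V (\<xi> t - k) = stream V (\<xi> s)"
    using Z2_periodicD[OF stream_periodic[OF smooth per div mean] k(1), of "\<xi> t - k"]
      stream_orbit[OF \<xi>, of t s] by simp
  then obtain u where u: "\<bar>u\<bar> \<le> \<tau>" "\<xi> t - k = \<xi> (s + u)"
    using flow_box[OF \<xi> fast \<open>\<delta> > 0\<close> \<open>\<tau> > 0\<close> small(1), of "\<xi> t - k"] k(2) small(2) by auto
  have lip_p: "p \<bullet> (\<xi> (s + u) - \<xi> s) \<le> norm p * (B * \<tau>)" if "\<bar>u\<bar> \<le> \<tau>" for u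
  proof -
    have "norm (\<xi> (s + u) - \<xi> s) \<le> B * \<bar>u\<bar>" using orbit_lipschitz[OF \<xi>, of "s + u" s] by simp
    also have "\<dots> \<le> B * \<tau>" using that pos by simp
    finally show ?thesis
      by (meson norm_cauchy_schwarz mult_left_mono norm_ge_zero order_trans)
  qed
  show ?thesis
  \<comment> \<open>\<open>s + \<tau> \<le> t\<close> excludes a negative period but not a zero one,
    hence this degenerate case.\<close>
  proof (cases "t = s + u")
    case True
    then show ?thesis using lip_p u by simp
  next
    case False
    define T where "T = t - (s + u)"
    have "periodic_orbit V (\<lambda>r. \<xi> ((s + u) + r)) T"
      unfolding periodic_orbit_def
      using orbit_shift[OF \<xi>, of "s + u"] False return(1) u k(1)
      by (auto simp: T_def abs_le_iff algebra_simps)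
    from no_drift[OF this] have "p \<bullet> (\<xi> t - \<xi> (s + u)) \<le> 0" by (simp add: T_def)
    then show ?thesis using lip_p[OF u(1)] by (simp add: inner_diff_right)
  qed
qed

text \<open>Steps on which the orbit is slow contribute little; the fast ones are confined to finitely many
  cells, and a return to the same cell costs at most \<open>\<bar>p\<bar> B \<tau>\<close>.\<close>

lemma drift_bound:
  assumes "\<delta> > 0"
    and no_drift: "\<And>\<zeta> T. periodic_orbit V \<zeta> T \<Longrightarrow> p \<bullet> (\<zeta> T - \<zeta> 0) \<le> 0"
  obtains \<tau> C where "\<tau> > 0" "C \<ge> 0"
    "\<And>\<xi> n. orbit V \<xi> \<Longrightarrow> p \<bullet> (\<xi> (real n * \<tau>) - \<xi> 0) \<le> real n * (norm p * (2 * \<delta> * \<tau>)) + C"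
proof -
  \<comment> \<open>In time \<tau> the velocity changes by at most L B \<tau> = \<delta> / 2. This
    meets the flow box condition with equality and keeps a step that starts slow below speed 2
    \<delta> throughout.\<close>
  define \<tau> where "\<tau> = \<delta> / (2 * L * B)"
  have \<tau>: "\<tau> > 0" "2 * L * B * \<tau> = \<delta>" using pos \<open>\<delta> > 0\<close> by (auto simp: \<tau>_def)
  obtain m :: nat where "4 / (\<tau> * \<delta>) < real m" using reals_Archimedean2 by blast
  moreover have c: "\<tau> * \<delta> > 0" using \<tau>(1) \<open>\<delta> > 0\<close> by simp
  ultimately have "4 < real m * (\<tau> * \<delta>)" by (simp only: pos_divide_less_eq)
  moreover from this have "m > 0" by (cases "m = 0") auto
  ultimately have m: "m > 0" "4 / real m \<le> \<tau> * \<delta>"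
    by (simp_all add: pos_divide_le_eq mult.commute)
  define S where "S = {0..<int m} \<times> {0..<int m}"
  \<comment> \<open>\<open>K\<close> serves twice: as the cost of a return and as the bound for a
    single step of duration \<tau>.\<close>
  define K where "K = norm p * (B * \<tau>)"
  have K: "K \<ge> 0" using pos \<tau> by (simp add: K_def)
  have bound: "p \<bullet> (\<xi> (real n * \<tau>) - \<xi> 0) \<le> real n * (norm p * (2 * \<delta> * \<tau>)) + real (card S) * (K + K)"
    if \<xi>: "orbit V \<xi>" for \<xi> n
  proof -
    define a where "a n = p \<bullet> \<xi> (real n * \<tau>)" for n :: nat
    have dev: "a (Suc n) - a n \<le> norm p * (c * \<tau>)"
      if "\<And>u. u \<in> closed_segment (real n * \<tau>) (real (Suc n) * \<tau>) \<Longrightarrow> norm (V (\<xi> u)) \<le> c" for n c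
    proof -
      have "norm (\<xi> (real (Suc n) * \<tau>) - \<xi> (real n * \<tau>)) \<le> c * \<bar>real (Suc n) * \<tau> - real n * \<tau>\<bar>"
        using orbit_deviation[OF \<xi>, of "real n * \<tau>" "real (Suc n) * \<tau>" 0 c] that by simp
      also have "\<dots> = c * \<tau>" using \<tau> by (simp add: algebra_simps)
      finally show ?thesis
        unfolding a_def inner_diff_right[symmetric]
        by (meson norm_cauchy_schwarz mult_left_mono norm_ge_zero order_trans)
    qed
    have "a n - a 0 \<le> real (n - 0) * (norm p * (2 * \<delta> * \<tau>)) + real (card S) * (K + K)"
    proof (rule jump_bound[where G = "{n. norm (V (\<xi> (real n * \<tau>))) \<ge> \<delta>}"
          and cell = "\<lambda>n. cell m (\<xi> (real n * \<tau>))"])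
      fix n assume n: "n \<notin> {n. norm (V (\<xi> (real n * \<tau>))) \<ge> \<delta>}"
      show "a (Suc n) - a n \<le> norm p * (2 * \<delta> * \<tau>)"
      proof (rule dev)
        fix u assume "u \<in> closed_segment (real n * \<tau>) (real (Suc n) * \<tau>)"
        then have u: "\<bar>u - real n * \<tau>\<bar> \<le> \<tau>"
          using \<tau> by (auto simp: closed_segment_eq_real_ivl algebra_simps split: if_splits)
        have "norm (V (\<xi> u) - V (\<xi> (real n * \<tau>))) \<le> L * (B * \<bar>u - real n * \<tau>\<bar>)"
          using lip order_trans mult_left_mono[OF orbit_lipschitz[OF \<xi>]] pos less_imp_le by meson
        also have "\<dots> \<le> L * (B * \<tau>)" using u pos by simp
        also have "\<dots> \<le> \<delta>" using \<tau> \<open>\<delta> > 0\<close> by simp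
        finally show "norm (V (\<xi> u)) \<le> 2 * \<delta>"
          using n norm_triangle_sub[of "V (\<xi> u)" "V (\<xi> (real n * \<tau>))"] by simp
      qed
    next
      show "a (Suc n) - a n \<le> K" for n
        unfolding K_def by (rule dev) (rule bnd)
    next
      fix k n assume kn: "k < n" "k \<in> {n. norm (V (\<xi> (real n * \<tau>))) \<ge> \<delta>}"
        "cell m (\<xi> (real k * \<tau>)) = cell m (\<xi> (real n * \<tau>))"
      have "real k * \<tau> + \<tau> \<le> real n * \<tau>"
        using kn(1) \<tau>(1) mult_right_mono[of "real (Suc k)" "real n" \<tau>] by (simp add: algebra_simps)
      from periodic_orbit_near_return[OF \<xi> _ \<open>\<delta> > 0\<close> \<tau>(1) eq_refl[OF \<tau>(2)] m(2,1) this kn(3) no_drift]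
      show "a n - a k \<le> K" using kn(2) by (simp add: a_def K_def inner_diff_right)
    next
      show "cell m (\<xi> (real n * \<tau>)) \<in> S" for n
        unfolding S_def by (rule cell_range[OF m(1)])
    qed (use K \<tau> \<open>\<delta> > 0\<close> in \<open>auto simp: S_def\<close>)
    then show ?thesis by (simp add: a_def inner_diff_right)
  qed
  show ?thesis
    by (rule that[OF \<tau>(1) _ bound]) (use K in simp_all)
qed

subsection \<open>The Euler scheme\<close>

definition euler :: "real \<Rightarrow> real^2 \<Rightarrow> real^2" where
  "euler h x = x + h *\<^sub>R V x"

text \<open>The chain rule for the iterates, that is, the Euler scheme of the variational
  equation.\<close>

fun euler_deriv :: "real \<Rightarrow> nat \<Rightarrow> real^2 \<Rightarrow> real^2 \<Rightarrow> real^2" where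
  "euler_deriv h 0 x v = v"
| "euler_deriv h (Suc n) x v = euler_deriv h n x v +
     h *\<^sub>R frechet_derivative V (at ((euler h ^^ n) x)) (euler_deriv h n x v)"

lemma deriv_V: "(V has_derivative frechet_derivative V (at x)) (at x)"
  by (rule C_infty_imp_has_derivative[OF smooth])

lemma euler_has_derivative:
  "((euler h ^^ n) has_derivative euler_deriv h n x) (at x)"
proof (induction n)
  case 0
  have "euler_deriv h 0 x = (\<lambda>v. v)" by auto
  then show ?case by (simp add: id_def)
next
  case (Suc n)
  have "((\<lambda>x. (euler h ^^ n) x + h *\<^sub>R V ((euler h ^^ n) x)) has_derivative
      (\<lambda>v. euler_deriv h n x v +
        h *\<^sub>R frechet_derivative V (at ((euler h ^^ n) x)) (euler_deriv h n x v))) (at x)"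
    by (intro has_derivative_add has_derivative_scaleR_right Suc
        has_derivative_compose[OF Suc deriv_V])
  moreover have "euler h ^^ Suc n = (\<lambda>x. (euler h ^^ n) x + h *\<^sub>R V ((euler h ^^ n) x))"
    by (simp add: fun_eq_iff euler_def[of h "(euler h ^^ n) _"])
  moreover have "euler_deriv h (Suc n) x = (\<lambda>v. euler_deriv h n x v +
      h *\<^sub>R frechet_derivative V (at ((euler h ^^ n) x)) (euler_deriv h n x v))"
    by (simp add: fun_eq_iff)
  ultimately show ?case by simp
qed

lemma continuous_on_euler: "continuous_on S (\<lambda>x. (euler h ^^ n) x)"
  by (intro continuous_at_imp_continuous_on ballI has_derivative_continuous[OF euler_has_derivative])

lemma continuous_on_euler_deriv: "continuous_on UNIV (\<lambda>x. euler_deriv h n x v)"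
proof (induction n)
  case (Suc n)
  have D_sum: "frechet_derivative V (at y) w = (\<Sum>b\<in>Basis. (w \<bullet> b) *\<^sub>R frechet_derivative V (at y) b)" for y w
    by (rule linear_eq_sum_Basis[OF has_derivative_bounded_linear[OF deriv_V]])
  have "continuous_on UNIV (\<lambda>x. frechet_derivative V (at ((euler h ^^ n) x)) b)" for b
    by (rule continuous_on_compose2[OF C_infty_imp_continuous_on[OF C_infty_frechet_derivative[OF smooth],
            where S = UNIV] continuous_on_euler]) simp
  then have "continuous_on UNIV
      (\<lambda>x. frechet_derivative V (at ((euler h ^^ n) x)) (euler_deriv h n x v))"
    by (subst D_sum) (intro continuous_on_sum continuous_on_scaleR continuous_on_inner Suc
        continuous_on_const)
  with Suc show ?case by (simp add: continuous_on_add continuous_on_scaleR)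
qed simp

lemma euler_translate:
  assumes "k \<in> Z2"
  shows "(euler h ^^ n) (x + k) = (euler h ^^ n) x + k"
  by (induction n) (simp_all add: euler_def Z2_periodicD[OF per assms])

text \<open>Mean value inequality for \<open>V\<close> minus its derivative at \<open>y\<close>;
  hence \<open>M\<close> in place of the sharp M / 2.\<close>

lemma taylor_V:
  "norm (V (y + w) - V y - frechet_derivative V (at y) w) \<le> M * (norm w)\<^sup>2"
proof -
  let ?D = "frechet_derivative V (at y)"
  have "norm ((V (y + w) - ?D (y + w)) - (V y - ?D y)) \<le> (M * norm w) * norm ((y + w) - y)"
  proof (rule differentiable_bound[where S = "closed_segment y (y + w)"
        and f' = "\<lambda>x v. frechet_derivative V (at x) v - ?D v"])
    fix x assume x: "x \<in> closed_segment y (y + w)"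
    show "((\<lambda>x. V x - ?D x) has_derivative (\<lambda>v. frechet_derivative V (at x) v - ?D v))
        (at x within closed_segment y (y + w))"
      by (intro has_derivative_diff has_derivative_at_withinI[OF deriv_V]
          bounded_linear_imp_has_derivative has_derivative_bounded_linear[OF deriv_V])
    have "norm (x - y) \<le> norm w"
      using segment_bound(1)[OF x] by simp
    then have "norm (frechet_derivative V (at x) v - ?D v) \<le> M * norm w * norm v" for v
      using deriv_lip[of x v y] pos by (meson less_imp_le mult_left_mono mult_right_mono norm_ge_zero order_trans)
    then show "onorm (\<lambda>v. frechet_derivative V (at x) v - ?D v) \<le> M * norm w"
      by (rule onorm_le)
  qed auto
  then show ?thesis
    by (simp add: linear_add[OF has_derivative_linear[OF deriv_V]] power2_eq_square algebra_simps)
qed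

text \<open>For the exact flow the pushforward of \<open>V x\<close> is \<open>V\<close> at the image point; the Euler scheme
  inherits this up to first order in the step.\<close>

lemma euler_deriv_error:
  assumes "h \<ge> 0"
  shows "norm (euler_deriv h n x (V x) - V ((euler h ^^ n) x)) \<le>
    real n * (M * B\<^sup>2 * h\<^sup>2) * exp (real n * (h * L))"
proof (rule discrete_gronwall)
  fix n
  define y where "y = (euler h ^^ n) x"
  define e where "e = euler_deriv h n x (V x) - V y"
  let ?D = "frechet_derivative V (at y)"
  have lin: "linear ?D" by (rule has_derivative_linear[OF deriv_V])
  \<comment> \<open>The linearised step acts on the error as I + h D; the defect is the Taylor
    remainder over one Euler step, of order h^2.\<close>
  have "euler_deriv h (Suc n) x (V x) - V ((euler h ^^ Suc n) x) =
      (e + h *\<^sub>R ?D e) - (V (y + h *\<^sub>R V y) - V y - ?D (h *\<^sub>R V y))"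
    by (simp add: e_def euler_def linear_diff[OF lin] linear_scale[OF lin] algebra_simps flip: y_def)
  also have "norm \<dots> \<le> (norm e + h * (L * norm e)) + M * (norm (h *\<^sub>R V y))\<^sup>2"
  proof (rule order_trans[OF norm_triangle_ineq4 add_mono[OF _ taylor_V]])
    have "norm (h *\<^sub>R ?D e) \<le> h * (L * norm e)"
      using mult_left_mono[OF deriv_le assms] assms by simp
    then show "norm (e + h *\<^sub>R ?D e) \<le> norm e + h * (L * norm e)"
      using norm_triangle_ineq[of e "h *\<^sub>R ?D e"] by linarith
  qed
  also have "M * (norm (h *\<^sub>R V y))\<^sup>2 \<le> M * (h * B)\<^sup>2"
    using pos assms bnd by (intro mult_left_mono power_mono) (auto intro: mult_left_mono)
  finally show "norm (euler_deriv h (Suc n) x (V x) - V ((euler h ^^ Suc n) x)) \<le>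
      (1 + h * L) * norm (euler_deriv h n x (V x) - V ((euler h ^^ n) x)) + M * B\<^sup>2 * h\<^sup>2"
    by (simp add: e_def y_def algebra_simps power_mult_distrib)
qed (use pos assms in auto)

text \<open>During a step the velocity of the orbit changes by at most L B h, which gives the local
  error L B h^2; earlier errors are amplified by 1 + h L.\<close>

lemma euler_orbit_error:
  assumes \<xi>: "orbit V \<xi>" "\<xi> 0 = x" and "h \<ge> 0"
  shows "norm ((euler h ^^ n) x - \<xi> (real n * h)) \<le> real n * (L * B * h\<^sup>2) * exp (real n * (h * L))"
proof (rule discrete_gronwall)
  fix n
  define y where "y = (euler h ^^ n) x"
  define z where "z = \<xi> (real n * h)"
  have "norm (\<xi> (real (Suc n) * h) - z - (real (Suc n) * h - real n * h) *\<^sub>R V z) \<le>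
      (L * (B * h)) * \<bar>real (Suc n) * h - real n * h\<bar>"
    unfolding z_def
  proof (rule orbit_deviation[OF \<xi>(1)])
    fix u assume "u \<in> closed_segment (real n * h) (real (Suc n) * h)"
    then have u: "\<bar>u - real n * h\<bar> \<le> h"
      using \<open>h \<ge> 0\<close> by (auto simp: closed_segment_eq_real_ivl algebra_simps split: if_splits)
    have "norm (V (\<xi> u) - V (\<xi> (real n * h))) \<le> L * (B * \<bar>u - real n * h\<bar>)"
      using lip order_trans mult_left_mono[OF orbit_lipschitz[OF \<xi>(1)]] pos less_imp_le by meson
    also have "\<dots> \<le> L * (B * h)" using u pos by simp
    finally show "norm (V (\<xi> u) - V (\<xi> (real n * h))) \<le> L * (B * h)" .
  qed
  then have dev: "norm (\<xi> (real (Suc n) * h) - z - h *\<^sub>R V z) \<le> L * B * h\<^sup>2"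
    using \<open>h \<ge> 0\<close> by (simp add: algebra_simps power2_eq_square)
  have "(euler h ^^ Suc n) x - \<xi> (real (Suc n) * h) =
      ((y - z) + h *\<^sub>R (V y - V z)) - (\<xi> (real (Suc n) * h) - z - h *\<^sub>R V z)"
    by (simp add: euler_def algebra_simps flip: y_def)
  also have "norm \<dots> \<le> (norm (y - z) + h * (L * norm (y - z))) + L * B * h\<^sup>2"
  proof (rule order_trans[OF norm_triangle_ineq4 add_mono[OF _ dev]])
    have "norm (h *\<^sub>R (V y - V z)) \<le> h * (L * norm (y - z))"
      using mult_left_mono[OF lip \<open>h \<ge> 0\<close>] \<open>h \<ge> 0\<close> by simp
    then show "norm (y - z + h *\<^sub>R (V y - V z)) \<le> norm (y - z) + h * (L * norm (y - z))"
      using norm_triangle_ineq[of "y - z" "h *\<^sub>R (V y - V z)"] by linarith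
  qed
  finally show "norm ((euler h ^^ Suc n) x - \<xi> (real (Suc n) * h)) \<le>
      (1 + h * L) * norm ((euler h ^^ n) x - \<xi> (real n * h)) + L * B * h\<^sup>2"
    by (simp add: y_def z_def algebra_simps)
qed (use pos \<xi> \<open>h \<ge> 0\<close> in auto)

text \<open>p . x plus this function is the average of p . y over the first \<open>N\<close> points
  y of the Euler orbit of x; subtracting p . x makes the average periodic.\<close>

definition corrector :: "real^2 \<Rightarrow> real \<Rightarrow> nat \<Rightarrow> real^2 \<Rightarrow> real" where
  "corrector p h N x = (\<Sum>n<N. p \<bullet> ((euler h ^^ n) x - x)) / real N"

lemma corrector_has_derivative:
  "(corrector p h N has_derivative (\<lambda>v. (\<Sum>n<N. p \<bullet> (euler_deriv h n x v - v)) / real N)) (at x)"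
proof -
  have "((\<lambda>x. (\<Sum>n<N. p \<bullet> ((euler h ^^ n) x - x)) / real N) has_derivative
      (\<lambda>v. (\<Sum>n<N. p \<bullet> (euler_deriv h n x v - v)) / real N)) (at x)"
    by (intro bounded_linear.has_derivative[OF bounded_linear_divide] has_derivative_sum
        bounded_linear.has_derivative[OF bounded_linear_inner_right] has_derivative_diff
        euler_has_derivative has_derivative_ident)
  then show ?thesis by (simp add: corrector_def[abs_def])
qed

lemma corrector_C1: "C_diff 1 (corrector p h N)"
proof -
  have "continuous_on UNIV (\<lambda>x. (\<Sum>n<N. p \<bullet> (euler_deriv h n x v - v)) / real N)" for v
    by (intro continuous_on_sum continuous_on_inner continuous_on_diff continuous_on_const
        continuous_on_euler_deriv bounded_linear.continuous_on[OF bounded_linear_divide])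
  then show ?thesis
    by (auto simp: differentiable_on_def frechet_derivative_at[OF corrector_has_derivative, symmetric]
        intro: differentiableI[OF corrector_has_derivative])
qed

lemma corrector_periodic: "Z2_periodic (corrector p h N)"
  by (simp add: Z2_periodic_def corrector_def euler_translate)

lemma euler_sum: "(\<Sum>n<N. h *\<^sub>R V ((euler h ^^ n) x)) = (euler h ^^ N) x - x"
  by (induction N) (simp_all add: euler_def[of h "(euler h ^^ _) _"])

text \<open>Euler increments telescope without remainder (\<open>euler_sum\<close>), so the
  displacement term is exact. The last sum measures how far the Euler map is from carrying
  \<open>V\<close> to itself.\<close>

lemma corrector_identity:
  assumes "h \<noteq> 0" "N > 0"
  shows "V x \<bullet> (p + gradient (corrector p h N) x) =
    p \<bullet> ((euler h ^^ N) x - x) / (real N * h) +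
    (\<Sum>n<N. p \<bullet> (euler_deriv h n x (V x) - V ((euler h ^^ n) x))) / real N"
proof -
  have "V x \<bullet> gradient (corrector p h N) x = (\<Sum>n<N. p \<bullet> (euler_deriv h n x (V x) - V x)) / real N"
    using inner_gradient[OF differentiableI[OF corrector_has_derivative]]
    by (simp add: frechet_derivative_at[OF corrector_has_derivative, symmetric])
  moreover have "p \<bullet> ((euler h ^^ N) x - x) / (real N * h) =
      (\<Sum>n<N. p \<bullet> V ((euler h ^^ n) x)) / real N"
    using assms
    by (simp add: inner_sum_right field_simps flip: euler_sum sum_distrib_left)
  ultimately show ?thesis
    using assms
    by (simp add: inner_add_right inner_commute[of "V x" p] inner_diff_right sum_subtractf field_simps)
qed

lemma exists_corrector:
  assumes "\<epsilon> > 0"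
    and no_drift: "\<And>\<zeta> T. periodic_orbit V \<zeta> T \<Longrightarrow> p \<bullet> (\<zeta> T - \<zeta> 0) \<le> 0"
  obtains u where "C_diff 1 u" "Z2_periodic u" "\<And>x. V x \<bullet> (p + gradient u x) \<le> \<epsilon>"
proof -
  \<comment> \<open>The 8 makes the slow contribution |p| 2 \<delta> at most \<epsilon> / 4; the
    added 1 covers p = 0.\<close>
  define \<delta> where "\<delta> = \<epsilon> / (8 * (norm p + 1))"
  have np: "norm p + 1 > 0" using norm_ge_zero[of p] by linarith
  have \<delta>: "\<delta> > 0" using \<open>\<epsilon> > 0\<close> np by (simp add: \<delta>_def)
  have "norm p * \<delta> \<le> (norm p + 1) * \<delta>" using \<delta> by simp
  also have "\<dots> = \<epsilon> / 8" using np by (simp add: \<delta>_def field_simps)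
  finally have p\<delta>: "norm p * (2 * \<delta>) \<le> \<epsilon> / 4" by simp
  obtain \<tau> C where \<tau>: "\<tau> > 0" and "C \<ge> 0" and drift: "\<And>\<xi> n. orbit V \<xi> \<Longrightarrow>
      p \<bullet> (\<xi> (real n * \<tau>) - \<xi> 0) \<le> real n * (norm p * (2 * \<delta> * \<tau>)) + C"
    using drift_bound[OF \<delta> no_drift] by blast
  \<comment> \<open>Long enough that the fixed cost \<open>C\<close> amounts to at most \<epsilon> /
    4 per unit time.\<close>
  obtain n :: nat where n: "C / (\<tau> * (\<epsilon> / 4)) < real n" using reals_Archimedean2 by blast
  define T where "T = real n * \<tau>"
  have "C / (\<tau> * (\<epsilon> / 4)) \<ge> 0" using \<tau> \<open>C \<ge> 0\<close> \<open>\<epsilon> > 0\<close> by simp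
  with n have "n > 0" by (cases "n = 0") auto
  then have T: "T > 0" using \<tau> by (simp add: T_def)
  have "C < real n * (\<tau> * (\<epsilon> / 4))"
    using n \<tau> \<open>\<epsilon> > 0\<close> by (subst (asm) pos_divide_less_eq) auto
  then have CT: "C \<le> T * (\<epsilon> / 4)" by (simp add: T_def)
  have drift_T: "p \<bullet> (\<xi> T - \<xi> 0) \<le> T * (\<epsilon> / 2)" if "orbit V \<xi>" for \<xi>
  proof -
    have "p \<bullet> (\<xi> T - \<xi> 0) \<le> T * (norm p * (2 * \<delta>)) + C"
      using drift[OF that, of n] by (simp add: T_def mult_ac)
    also have "\<dots> \<le> T * (\<epsilon> / 4) + T * (\<epsilon> / 4)"
      using p\<delta> T CT by (intro add_mono mult_left_mono) auto
    finally show ?thesis by simp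
  qed
  \<comment> \<open>The coefficient of \<open>h\<close> in the total Euler error:
    \<open>L * B\<close> from the displacement, after division by \<open>T\<close>, and
    \<open>T * M * B\<^sup>2\<close> from the derivatives.\<close>
  define Q where "Q = norm p * exp (T * L) * (L * B + T * M * B\<^sup>2)"
  obtain N0 :: nat where "T * Q / (\<epsilon> / 4) < real N0" using reals_Archimedean2 by blast
  moreover define N where "N = Suc N0"
  ultimately have "T * Q / (\<epsilon> / 4) \<le> real N" by simp
  then have "T * Q \<le> real N * (\<epsilon> / 4)"
    using \<open>\<epsilon> > 0\<close> by (subst (asm) pos_divide_le_eq) auto
  moreover define h where "h = T / real N"
  ultimately have Qh: "Q * h \<le> \<epsilon> / 4"
    by (simp add: N_def pos_divide_le_eq mult.commute)
  have N: "N > 0" and Nh: "real N * h = T" and h: "h > 0"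
    using T by (auto simp: N_def h_def)
  have "V x \<bullet> (p + gradient (corrector p h N) x) \<le> \<epsilon>" for x
  proof -
    obtain \<xi> where \<xi>: "\<xi> 0 = x" "\<And>t. (\<xi> has_vector_derivative V (\<xi> t)) (at t)"
      using global_solution[OF lip pos(1) bnd] by blast
    have orb: "orbit V \<xi>" by (rule orbitI[OF smooth \<xi>(2)])
    have "norm ((euler h ^^ N) x - \<xi> T) \<le> T * (L * B * h) * exp (T * L)"
      using euler_orbit_error[OF orb \<xi>(1), of h N] h
      by (simp add: power2_eq_square mult_ac flip: Nh)
    then have "p \<bullet> ((euler h ^^ N) x - \<xi> T) \<le> norm p * (T * (L * B * h) * exp (T * L))"
      by (meson norm_cauchy_schwarz mult_left_mono norm_ge_zero order_trans)
    with drift_T[OF orb]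
    have "p \<bullet> ((euler h ^^ N) x - x) \<le> T * (\<epsilon> / 2 + norm p * (L * B * h) * exp (T * L))"
      by (simp add: \<xi>(1) inner_diff_right algebra_simps)
    then have main: "p \<bullet> ((euler h ^^ N) x - x) / (real N * h) \<le>
        \<epsilon> / 2 + norm p * (L * B * h) * exp (T * L)"
      unfolding Nh using T by (simp add: pos_divide_le_eq mult.commute)
    have "p \<bullet> (euler_deriv h i x (V x) - V ((euler h ^^ i) x)) \<le>
        norm p * (T * (M * B\<^sup>2 * h) * exp (T * L))" if "i < N" for i
    proof -
      have ih: "real i * h \<le> T" unfolding Nh[symmetric] using that h by (intro mult_right_mono) auto
      have "norm (euler_deriv h i x (V x) - V ((euler h ^^ i) x)) \<le>
          (real i * h) * (M * B\<^sup>2 * h) * exp ((real i * h) * L)"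
        using euler_deriv_error[of h i x] h by (simp add: power2_eq_square mult_ac)
      also have "\<dots> \<le> T * (M * B\<^sup>2 * h) * exp (T * L)"
        using ih pos h T by (intro mult_mono) auto
      finally show ?thesis
        by (meson norm_cauchy_schwarz mult_left_mono norm_ge_zero order_trans)
    qed
    then have "(\<Sum>i<N. p \<bullet> (euler_deriv h i x (V x) - V ((euler h ^^ i) x))) \<le>
        real N * (norm p * (T * (M * B\<^sup>2 * h) * exp (T * L)))"
      using sum_bounded_above[of "{..<N}" "\<lambda>i. p \<bullet> (euler_deriv h i x (V x) - V ((euler h ^^ i) x))"]
      by simp
    then have "(\<Sum>i<N. p \<bullet> (euler_deriv h i x (V x) - V ((euler h ^^ i) x))) / real N \<le>
        norm p * (T * (M * B\<^sup>2 * h) * exp (T * L))"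
      using N by (simp add: pos_divide_le_eq mult.commute)
    with main have "V x \<bullet> (p + gradient (corrector p h N) x) \<le> \<epsilon> / 2 + Q * h"
      unfolding corrector_identity[OF less_imp_neq[OF h, symmetric] N] Q_def
      by (simp add: algebra_simps)
    with Qh \<open>\<epsilon> > 0\<close> show ?thesis by linarith
  qed
  then show ?thesis by (rule that[OF corrector_C1 corrector_periodic])
qed

subsection \<open>The effective constant\<close>

lemma bdd_above_directional:
  assumes "C_diff 1 \<phi>" "Z2_periodic \<phi>"
  shows "bdd_above (range (\<lambda>x. V x \<bullet> (p + gradient \<phi> x)))"
proof -
  obtain K where K: "K > 0" "\<And>x v. norm (frechet_derivative \<phi> (at x) v) \<le> K * norm v"
    using C1_periodic_lipschitz[OF assms(2,1)] by metis
  have "V x \<bullet> (p + gradient \<phi> x) \<le> B * norm p + K * B" for x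
  proof -
    have "V x \<bullet> p \<le> B * norm p"
      using norm_cauchy_schwarz[of "V x" p] mult_right_mono[OF bnd[of x] norm_ge_zero[of p]] by linarith
    moreover have "frechet_derivative \<phi> (at x) (V x) \<le> K * B"
      using K(2)[of x "V x"] mult_left_mono[OF bnd[of x], of K] K(1)
      unfolding real_norm_def by linarith
    moreover have "V x \<bullet> gradient \<phi> x = frechet_derivative \<phi> (at x) (V x)"
      using assms(1) by (intro inner_gradient) (simp add: differentiable_on_def)
    ultimately show ?thesis by (simp add: inner_add_right)
  qed
  then show ?thesis by (intro bdd_aboveI2) auto
qed

text \<open>At a maximum point of \<open>\<phi>\<close> the gradient vanishes.\<close>

lemma SUP_directional_ge:
  assumes "C_diff 1 \<phi>" "Z2_periodic \<phi>"
  shows "- (B * norm p) \<le> (SUP x. V x \<bullet> (p + gradient \<phi> x))"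
proof -
  have D: "(\<phi> has_derivative frechet_derivative \<phi> (at x)) (at x)" for x
    using assms(1) by (auto simp: differentiable_on_def frechet_derivative_works)
  then have "continuous_on UNIV \<phi>"
    by (meson continuous_at_imp_continuous_on has_derivative_continuous)
  from compact_attains_sup[OF Z2_periodic_compact_range[OF assms(2) this]]
  obtain x where x: "\<And>y. \<phi> y \<le> \<phi> x" by auto
  have "frechet_derivative \<phi> (at x) = (\<lambda>v. 0)"
    by (rule differential_zero_maxmin[of x UNIV, OF _ _ D]) (auto simp: x)
  then have "V x \<bullet> gradient \<phi> x = 0"
    using inner_gradient[OF differentiableI[OF D]] by simp
  moreover have "- (B * norm p) \<le> V x \<bullet> p"
    using Cauchy_Schwarz_ineq2[of "V x" p] mult_right_mono[OF bnd[of x] norm_ge_zero[of p]] by linarith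
  ultimately have "- (B * norm p) \<le> V x \<bullet> (p + gradient \<phi> x)" by (simp add: inner_add_right)
  also have "\<dots> \<le> (SUP x. V x \<bullet> (p + gradient \<phi> x))"
    by (intro cSUP_upper bdd_above_directional assms) auto
  finally show ?thesis .
qed

text \<open>Along the orbit, p . \<xi> + \<phi>(\<xi>) has derivative V . (p + D\<phi>), and \<phi>
  takes the same value at both ends. The mean value theorem yields a point where that derivative
  equals the mean drift.\<close>

lemma SUP_directional_ge_drift:
  assumes "C_diff 1 \<phi>" "Z2_periodic \<phi>" and \<xi>: "periodic_orbit V \<xi> T"
  shows "p \<bullet> (\<xi> T - \<xi> 0) / T \<le> (SUP x. V x \<bullet> (p + gradient \<phi> x))"
proof -
  have T: "T > 0" "orbit V \<xi>" "\<xi> T - \<xi> 0 \<in> Z2" using \<xi> by (auto simp: periodic_orbit_def)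
  have D: "(\<phi> has_derivative frechet_derivative \<phi> (at x)) (at x)" for x
    using assms(1) by (auto simp: differentiable_on_def frechet_derivative_works)
  define G where "G x = V x \<bullet> (p + gradient \<phi> x)" for x
  have "((\<lambda>t. p \<bullet> \<xi> t + \<phi> (\<xi> t)) has_real_derivative G (\<xi> t)) (at t)" for t
  proof -
    note \<xi>' = orbit_deriv[OF T(2), of t]
    have "((\<lambda>t. \<phi> (\<xi> t)) has_vector_derivative frechet_derivative \<phi> (at (\<xi> t)) (V (\<xi> t))) (at t)"
      using has_derivative_compose[OF \<xi>'[unfolded has_vector_derivative_def] D]
        linear_scale[OF has_derivative_linear[OF D]]
      by (simp add: has_vector_derivative_def)
    from has_vector_derivative_add[OF bounded_linear.has_vector_derivative[OF bounded_linear_inner_right \<xi>'] this]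
    show ?thesis
      unfolding has_real_derivative_iff_has_vector_derivative G_def
      by (simp add: inner_add_right inner_gradient[OF differentiableI[OF D]] inner_commute)
  qed
  from MVT2[OF T(1) this] obtain t where
    "p \<bullet> \<xi> T + \<phi> (\<xi> T) - (p \<bullet> \<xi> 0 + \<phi> (\<xi> 0)) = (T - 0) * G (\<xi> t)" by blast
  moreover have "\<phi> (\<xi> T) = \<phi> (\<xi> 0)"
    using Z2_periodicD[OF assms(2) T(3), of "\<xi> 0"] by simp
  ultimately have "p \<bullet> (\<xi> T - \<xi> 0) / T = G (\<xi> t)"
    using T(1) by (simp add: inner_diff_right field_simps)
  also have "\<dots> \<le> (SUP x. V x \<bullet> (p + gradient \<phi> x))"
    unfolding G_def by (intro cSUP_upper bdd_above_directional assms) auto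
  finally show ?thesis .
qed

lemma effective_c_pos_iff:
  "effective_c V p > 0 \<longleftrightarrow> (\<exists>\<xi> T. periodic_orbit V \<xi> T \<and> p \<bullet> (\<xi> T - \<xi> 0) > 0)"
proof
  assume c: "effective_c V p > 0"
  show "\<exists>\<xi> T. periodic_orbit V \<xi> T \<and> p \<bullet> (\<xi> T - \<xi> 0) > 0"
  proof (rule ccontr)
    assume "\<not> ?thesis"
    then have no_drift: "p \<bullet> (\<zeta> T - \<zeta> 0) \<le> 0" if "periodic_orbit V \<zeta> T" for \<zeta> T
      using that by (meson not_le)
    obtain u where u: "C_diff 1 u" "Z2_periodic u"
      and le: "\<And>x. V x \<bullet> (p + gradient u x) \<le> effective_c V p / 2"
      using exists_corrector[OF half_gt_zero[OF c] no_drift] by blast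
    \<comment> \<open>The lower bound - B |p|, uniform in \<phi>, is what places the real infimum
      below each member of the set.\<close>
    have "effective_c V p \<le> (SUP x. V x \<bullet> (p + gradient u x))"
      unfolding effective_c_def
      using u by (intro cINF_lower bdd_belowI2[of _ "- (B * norm p)"] SUP_directional_ge) auto
    also have "\<dots> \<le> effective_c V p / 2"
      by (intro cSUP_least le) auto
    finally show False using c by simp
  qed
next
  assume "\<exists>\<xi> T. periodic_orbit V \<xi> T \<and> p \<bullet> (\<xi> T - \<xi> 0) > 0"
  then obtain \<xi> T where \<xi>: "periodic_orbit V \<xi> T" and drift: "p \<bullet> (\<xi> T - \<xi> 0) > 0" by blast
  have "frechet_derivative (\<lambda>x :: real^2. 0 :: real) (at x) = (\<lambda>v. 0)" for x
    by (simp add: frechet_derivative_const)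
  then have "C_diff 1 (\<lambda>x :: real^2. 0 :: real) \<and> Z2_periodic (\<lambda>x. 0 :: real)"
    by (simp add: Z2_periodic_def)
  then have "{\<phi> :: real^2 \<Rightarrow> real. C_diff 1 \<phi> \<and> Z2_periodic \<phi>} \<noteq> {}" by blast
  then have "p \<bullet> (\<xi> T - \<xi> 0) / T \<le> effective_c V p"
    unfolding effective_c_def by (rule cINF_greatest) (auto intro: SUP_directional_ge_drift[OF _ _ \<xi>])
  moreover have "p \<bullet> (\<xi> T - \<xi> 0) / T > 0"
    using drift \<xi> by (simp add: periodic_orbit_def)
  ultimately show "effective_c V p > 0" by linarith
qed

end

section \<open>Constants of the flow and conclusion\<close>

lemma C_infty_imp_C_diff: "C_infty f \<Longrightarrow> C_diff k f"
  by (simp add: C_infty_def)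

text \<open>Each derivative of \<open>V\<close> in a basis direction is again smooth and periodic,
  hence Lipschitz; summing these constants over the basis gives \<open>M\<close>.\<close>

lemma torus_flow_exists:
  assumes V: "C_infty V" and per: "Z2_periodic V"
    and div: "\<forall>x. divergence V x = 0" and mean: "mean_torus V = 0"
  obtains L B M where "torus_flow V L B M"
proof -
  obtain L where L: "L > 0" "\<And>x y. norm (V x - V y) \<le> L * norm (x - y)"
    "\<And>x v. norm (frechet_derivative V (at x) v) \<le> L * norm v"
    using C1_periodic_lipschitz[OF per C_infty_imp_C_diff[OF V]] by metis
  obtain B where B: "B > 0" "\<And>x. norm (V x) \<le> B"
    using Z2_periodic_bounded[OF per C_infty_imp_continuous_on[OF V]] by metis
  let ?D = "\<lambda>x. frechet_derivative V (at x)"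
  have "\<exists>K>0. \<forall>x y. norm (?D x b - ?D y b) \<le> K * norm (x - y)" for b
  proof -
    have "Z2_periodic (\<lambda>x. ?D x b)"
      using frechet_derivative_periodic[OF per C_infty_imp_differentiable[OF V]]
      by (simp add: Z2_periodic_def)
    from C1_periodic_lipschitz[OF this C_infty_imp_C_diff[OF C_infty_frechet_derivative[OF V]]]
    show ?thesis by metis
  qed
  then obtain K where K: "\<And>b. K b > 0" "\<And>b x y. norm (?D x b - ?D y b) \<le> K b * norm (x - y)"
    by metis
  define M where "M = (\<Sum>b\<in>Basis. K b)"
  have "norm (?D x v - ?D y v) \<le> M * norm (x - y) * norm v" for x y v
  proof -
    have lin: "bounded_linear (\<lambda>v. ?D x v - ?D y v)"
      by (intro bounded_linear_sub has_derivative_bounded_linear[OF C_infty_imp_has_derivative[OF V]])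
    have "norm (?D x v - ?D y v) = norm (\<Sum>b\<in>Basis. (v \<bullet> b) *\<^sub>R (?D x b - ?D y b))"
      by (subst linear_eq_sum_Basis[OF lin]) simp
    also have "\<dots> \<le> (\<Sum>b\<in>Basis. norm v * (K b * norm (x - y)))"
      by (rule sum_norm_le) (auto intro!: mult_mono K Basis_le_norm)
    also have "\<dots> = M * norm (x - y) * norm v"
      by (simp add: M_def sum_distrib_left sum_distrib_right mult_ac)
    finally show ?thesis .
  qed
  moreover have "M > 0" unfolding M_def by (intro sum_pos) (auto simp: K)
  ultimately have "torus_flow V L B M"
    using assms L B by unfold_locales auto
  then show ?thesis by (rule that)
qed

theorem corollary3p1:
  fixes V :: "real^2 \<Rightarrow> real^2" and p :: "real^2"
  assumes "C_infty V" and "Z2_periodic V"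
    and "\<forall>x. divergence V x = 0"
    and "mean_torus V = 0"
  shows "effective_c V p > 0 \<longleftrightarrow>
    (\<exists>\<xi> T. periodic_orbit V \<xi> T \<and> p \<bullet> (\<xi> T - \<xi> 0) > 0)"
proof -
  obtain L B M where "torus_flow V L B M"
    using torus_flow_exists[OF assms] by blast
  then show ?thesis by (rule torus_flow.effective_c_pos_iff)
qed

end
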